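(* In the Gaussian sequential learning model described in the context with smooth randomized response and privacy budget $\varepsilon\in(0,\infty)$, let $C(\varepsilon)=\frac{\varepsilon\sigma^2}{4}\left(e^{\varepsilon+\frac{\varepsilon^2\sigma^2}{2}}-e^{-\varepsilon+\frac{\varepsilon^2\sigma^2}{2}}\right)$ and $f(n)=\frac{2}{\varepsilon\sigma^2}\log(C(\varepsilon)n)$. Then, conditional on $\theta=+1$, $\lim_{n\to\infty} l_n/f(n)=1$ with probability $1$; in particular $f(n)\sim\frac{2}{\varepsilon\sigma^2}\log n$.
   Context: Gaussian model: unknown state $\theta\in\{-1,+1\}$ with uniform prior; agents $n=1,2,\dots$ act in sequence; agent $n$ privately observes $s_n\sim\mathcal{N}(\theta,\sigma^2)$, i.i.d. given $\theta$, $\sigma>0$. The public log-likelihood ratio is $l_n=\log\frac{\mathbb{P}(\theta=+1\mid x_1,\dots,x_{n-1})}{\mathbb{P}(\theta=-1\mid x_1,\dots,x_{n-1})}$, $l_1=0$, where $x_i\in\{-1,+1\}$ are reported actions. With $t(l)=-\sigma^2l/2$, agent $n$'s intended action is $a_n=+1$ if $s_n>t(l_n)$, else $-1$; under smooth randomized response she reports $x_n=a_n$ with probability $1-u_n(s_n)$ and $x_n=-a_n$ with probability $u_n(s_n)=\frac12e^{-\varepsilon|s_n-t(l_n)|}$. Thus $l_{n+1}=l_n+\log\frac{\mathbb{P}(x_n\mid l_n,\theta=+1)}{\mathbb{P}(x_n\mid l_n,\theta=-1)}$ where $\mathbb{P}(x_n=+1\mid l,\theta)=\int_{\mathbb{R}}\phi_\theta(s)\big[\mathbf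 1\{s>t(l)\}(1-\tfrac12e^{-\varepsilon|s-t(l)|})+\mathbf 1\{s\le t(l)\}\tfrac12e^{-\varepsilon|s-t(l)|}\big]ds$ with $\phi_\theta$ the $\mathcal{N}(\theta,\sigma^2)$ density. Notation $f\sim g$ means $f(n)/g(n)\to1$. *)

theory Defs
  imports "HOL-Probability.Probability"
begin

definition thr :: "real \<Rightarrow> real \<Rightarrow> real" where
  "thr \<sigma> l = - (\<sigma>\<^sup>2 * l / 2)"

definition flip_prob :: "real \<Rightarrow> real \<Rightarrow> real \<Rightarrow> real \<Rightarrow> real" where
  "flip_prob \<epsilon> \<sigma> l s = exp (- \<epsilon> * \<bar>s - thr \<sigma> l\<bar>) / 2"

definition intended :: "real \<Rightarrow> real \<Rightarrow> real \<Rightarrow> real" where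
  "intended \<sigma> l s = (if s > thr \<sigma> l then 1 else -1)"

text \<open>Reported action: using an independent uniform coin v in [0,1], the report
  is flipped (x = -a) exactly when v < u(s), i.e. with probability u(s).\<close>
definition report :: "real \<Rightarrow> real \<Rightarrow> real \<Rightarrow> real \<Rightarrow> real \<Rightarrow> real" where
  "report \<epsilon> \<sigma> l s v = (if v < flip_prob \<epsilon> \<sigma> l s then - intended \<sigma> l s else intended \<sigma> l s)"

definition prob_plus :: "real \<Rightarrow> real \<Rightarrow> real \<Rightarrow> real \<Rightarrow> real" where
  "prob_plus \<epsilon> \<sigma> l \<theta> =
     (\<integral>s. normal_density \<theta> \<sigma> s *
        (if s > thr \<sigma> l then 1 - flip_prob \<epsilon> \<sigma> l s else flip_prob \<epsilon> \<sigma> l s) \<partial>lborel)"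

definition prob_report :: "real \<Rightarrow> real \<Rightarrow> real \<Rightarrow> real \<Rightarrow> real \<Rightarrow> real" where
  "prob_report \<epsilon> \<sigma> l \<theta> x = (if x = 1 then prob_plus \<epsilon> \<sigma> l \<theta> else 1 - prob_plus \<epsilon> \<sigma> l \<theta>)"

definition llr_update :: "real \<Rightarrow> real \<Rightarrow> real \<Rightarrow> real \<Rightarrow> real" where
  "llr_update \<epsilon> \<sigma> l x = l + ln (prob_report \<epsilon> \<sigma> l 1 x / prob_report \<epsilon> \<sigma> l (-1) x)"

text \<open>Public LLR l_n (n \<ge> 1; index 0 is a dummy), driven by the signals s n and
  randomization coins v n of agents n = 1, 2, ...:
  l_1 = 0, l_{n+1} = l_n + log-likelihood ratio of the report x_n.\<close>
fun pub_llr :: "real \<Rightarrow> real \<Rightarrow> (nat \<Rightarrow> real) \<Rightarrow> (nat \<Rightarrow> real) \<Rightarrow> nat \<Rightarrow> real" where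
  "pub_llr \<epsilon> \<sigma> s v 0 = 0"
| "pub_llr \<epsilon> \<sigma> s v (Suc 0) = 0"
| "pub_llr \<epsilon> \<sigma> s v (Suc (Suc n)) =
     (let l = pub_llr \<epsilon> \<sigma> s v (Suc n)
      in llr_update \<epsilon> \<sigma> l (report \<epsilon> \<sigma> l (s (Suc n)) (v (Suc n))))"

definition C_const :: "real \<Rightarrow> real \<Rightarrow> real" where
  "C_const \<epsilon> \<sigma> = \<epsilon> * \<sigma>\<^sup>2 / 4 *
     (exp (\<epsilon> + \<epsilon>\<^sup>2 * \<sigma>\<^sup>2 / 2) - exp (- \<epsilon> + \<epsilon>\<^sup>2 * \<sigma>\<^sup>2 / 2))"

definition f_rate :: "real \<Rightarrow> real \<Rightarrow> nat \<Rightarrow> real" where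
  "f_rate \<epsilon> \<sigma> n = 2 / (\<epsilon> * \<sigma>\<^sup>2) * ln (C_const \<epsilon> \<sigma> * real n)"

end

theory Submission
  imports Defs "HOL-Real_Asymp.Real_Asymp"
begin

text \<open>
  Write \<open>a = \<epsilon> * \<sigma>\<^sup>2 / 2\<close>. A report \<open>+1\<close> raises the log-likelihood ratio \<open>l\<close> by at most a constant
  times \<open>exp (- a * l)\<close> and a report \<open>-1\<close> lowers it, so \<open>exp (a * l\<^sub>n)\<close> grows at most linearly along
  every path; this is the upper bound. For the lower bound consider \<open>Z\<^sub>n = exp (- l\<^sub>n / 2)\<close>. Its conditional
  one-step contraction factor is the Bhattacharyya coefficient of the two report distributions, which is at
  most \<open>1 - \<kappa> * exp (- a * \<bar>l\<^sub>n\<bar>)\<close>. Together with \<open>E exp (- l\<^sub>n) = 1\<close> this yields a recursion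
  \<open>m\<^sub>n\<^sub>+\<^sub>1 \<le> m\<^sub>n - c * m\<^sub>n powr (1 + 2 * a)\<close> for \<open>m\<^sub>n = E Z\<^sub>n\<close>, hence
  \<open>m\<^sub>n = O(n powr (- 1 / (2 * a)))\<close>. The maximal inequality for the supermartingale \<open>Z\<close> on the blocks
  \<open>[2\<^sup>k, 2\<^sup>k\<^sup>+\<^sup>1]\<close> and the Borel--Cantelli lemma turn this into an almost sure bound.
\<close>

subsection \<open>Report probabilities\<close>

text \<open>Distribution function of the symmetric Laplace law with rate \<open>\<epsilon>\<close>.
  At \<open>s - thr \<sigma> l\<close> it is the probability of reporting \<open>+1\<close> on
  signal \<open>s\<close>, so smooth randomized response acts like adding Laplace noise before
  thresholding.\<close>

definition laplace_cdf :: "real \<Rightarrow> real \<Rightarrow> real" where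
  "laplace_cdf \<epsilon> x = (if x > 0 then 1 - exp (- \<epsilon> * x) / 2 else exp (\<epsilon> * x) / 2)"

lemma borel_measurable_laplace_cdf [measurable]: "laplace_cdf \<epsilon> \<in> borel_measurable borel"
  unfolding laplace_cdf_def[abs_def] by measurable

lemma laplace_cdf_minus: "laplace_cdf \<epsilon> (- x) = 1 - laplace_cdf \<epsilon> x"
  by (auto simp: laplace_cdf_def)

lemma laplace_cdf_pos: "\<epsilon> > 0 \<Longrightarrow> laplace_cdf \<epsilon> x > 0"
proof -
  assume "\<epsilon> > 0"
  have "exp (- \<epsilon> * x) \<le> 1" if "x > 0" using that \<open>\<epsilon> > 0\<close> by simp
  then have "exp (- \<epsilon> * x) / 2 < 1" if "x > 0" using that by linarith
  then show ?thesis by (simp add: laplace_cdf_def)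
qed

lemma laplace_cdf_less_one: "\<epsilon> > 0 \<Longrightarrow> laplace_cdf \<epsilon> x < 1"
  using laplace_cdf_pos[of \<epsilon> "- x"] by (simp add: laplace_cdf_minus)

lemma two_le_exp_plus_exp_minus: "2 \<le> exp x + exp (- x)" for x :: real
proof -
  have "0 \<le> (exp (x/2) - exp (-x/2))\<^sup>2" by simp
  also have "\<dots> = exp x + exp (- x) - 2"
    by (simp add: power2_eq_square algebra_simps flip: exp_add)
  finally show ?thesis by simp
qed

text \<open>The left branch extends to a bound on the whole line: for positive \<open>x\<close> it
  reduces to \<open>exp y + exp (- y) \<ge> 2\<close>. Gaussian integrals of the bound are
  explicit.\<close>

lemma laplace_cdf_le_exp: "laplace_cdf \<epsilon> x \<le> exp (\<epsilon> * x) / 2"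
  using two_le_exp_plus_exp_minus[of "\<epsilon> * x"] by (simp add: laplace_cdf_def field_simps)

lemma laplace_cdf_mono:
  assumes "\<epsilon> > 0" "x \<le> y" shows "laplace_cdf \<epsilon> x \<le> laplace_cdf \<epsilon> y"
proof -
  have "exp (\<epsilon> * x) \<le> 1" if "x \<le> 0" using that assms by (simp add: mult_nonneg_nonpos)
  moreover have "exp (- \<epsilon> * y) \<le> 1" if "y > 0" using that assms by simp
  ultimately have "exp (\<epsilon> * x) / 2 \<le> 1 - exp (- \<epsilon> * y) / 2" if "x \<le> 0" "y > 0"
    using that by linarith
  then show ?thesis using assms by (simp add: laplace_cdf_def)
qed

text \<open>The logarithm of the Laplace distribution function has slope at most
  \<open>\<epsilon>\<close>. This privacy property later bounds the likelihood ratio of every single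
  report.\<close>

lemma laplace_cdf_shift:
  assumes "\<epsilon> > 0" "h \<ge> 0"
  shows "laplace_cdf \<epsilon> (x + h) \<le> exp (\<epsilon> * h) * laplace_cdf \<epsilon> x"
proof (cases "x > 0")
  case False
  have "exp (\<epsilon> * (x + h)) / 2 = exp (\<epsilon> * h) * laplace_cdf \<epsilon> x"
    using False by (simp add: laplace_cdf_def distrib_left exp_add)
  with laplace_cdf_le_exp[of \<epsilon> "x + h"] show ?thesis by simp
next
  case True
  have 1: "exp (\<epsilon> * h) - exp (- (\<epsilon> * h)) \<ge> 0" using assms by simp
  \<comment> \<open>For positive \<open>x\<close> the claim rearranges to an upper bound on this
    product by \<open>2 * (exp (\<epsilon> * h) - 1)\<close>.\<close>
  have "exp (- (\<epsilon> * x)) * (exp (\<epsilon> * h) - exp (- (\<epsilon> * h)))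
        \<le> 1 * (exp (\<epsilon> * h) - exp (- (\<epsilon> * h)))"
    using True assms by (intro mult_right_mono 1) simp
  also have "\<dots> \<le> 2 * (exp (\<epsilon> * h) - 1)"
    using two_le_exp_plus_exp_minus[of "\<epsilon> * h"] by simp
  finally show ?thesis using True assms
    by (simp add: laplace_cdf_def algebra_simps exp_add exp_diff) (simp add: exp_minus field_simps exp_add)
qed

section \<open>Normal smoothing of the Laplace distribution function\<close>

locale privacy_params =
  fixes \<epsilon> \<sigma> :: real
  assumes eps_pos: "\<epsilon> > 0" and sigma_pos: "\<sigma> > 0"
begin

text \<open>Distribution function of the sum of an independent centred normal and a Laplace
  variable. All report probabilities are values of this one function.\<close>

definition A :: "real \<Rightarrow> real" where
  "A c = (\<integral>u. normal_density 0 \<sigma> u * laplace_cdf \<epsilon> (u + c) \<partial>lborel)"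

lemma integrable_A [simp]:
  "integrable lborel (\<lambda>u. normal_density 0 \<sigma> u * laplace_cdf \<epsilon> (u + c))"
proof (rule Bochner_Integration.integrable_bound[OF integrable_normal_density[OF sigma_pos, of 0]])
  show "AE u in lborel. norm (normal_density 0 \<sigma> u * laplace_cdf \<epsilon> (u + c)) \<le> norm (normal_density 0 \<sigma> u)"
    using less_imp_le[OF laplace_cdf_pos[OF eps_pos]] less_imp_le[OF laplace_cdf_less_one[OF eps_pos]]
    by (intro AE_I2) (simp add: abs_mult mult_left_le)
qed simp

text \<open>Centring the signal by \<open>s = \<theta> + u\<close> leaves the integrand depending on
  state and belief only through their sum
  \<open>\<theta> + \<sigma>\<^sup>2 * l / 2\<close>.\<close>

lemma prob_plus_eq_A: "prob_plus \<epsilon> \<sigma> l \<theta> = A (\<theta> + \<sigma>\<^sup>2 * l / 2)"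
proof -
  have "prob_plus \<epsilon> \<sigma> l \<theta> =
    (\<integral>s. normal_density \<theta> \<sigma> s * laplace_cdf \<epsilon> (s - thr \<sigma> l) \<partial>lborel)"
    unfolding prob_plus_def
    by (intro Bochner_Integration.integral_cong) (auto simp: laplace_cdf_def flip_prob_def abs_if algebra_simps)
  also have "\<dots> = (\<integral>u. normal_density \<theta> \<sigma> (\<theta> + u) * laplace_cdf \<epsilon> ((\<theta> + u) - thr \<sigma> l) \<partial>lborel)"
    using lborel_integral_real_affine[of 1 "\<lambda>s. normal_density \<theta> \<sigma> s * laplace_cdf \<epsilon> (s - thr \<sigma> l)" \<theta>]
    by simp
  also have "\<dots> = A (\<theta> + \<sigma>\<^sup>2 * l / 2)"
    unfolding A_def
    by (intro Bochner_Integration.integral_cong) (auto simp: normal_density_def thr_def algebra_simps)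
  finally show ?thesis .
qed

text \<open>Both the normal and the Laplace law are symmetric, so reflect \<open>u\<close>. Reports
  \<open>-1\<close> can then be treated as reports \<open>+1\<close> at the reflected
  argument.\<close>

lemma A_minus: "A (- c) = 1 - A c"
proof -
  have "A (- c) = (\<integral>u. normal_density 0 \<sigma> (- u) * laplace_cdf \<epsilon> (- u - c) \<partial>lborel)"
    unfolding A_def
    using lborel_integral_real_affine[of "-1" "\<lambda>u. normal_density 0 \<sigma> u * laplace_cdf \<epsilon> (u - c)" 0]
    by simp
  also have "\<dots> = (\<integral>u. normal_density 0 \<sigma> u - normal_density 0 \<sigma> u * laplace_cdf \<epsilon> (u + c) \<partial>lborel)"
  proof (intro Bochner_Integration.integral_cong refl)
    fix u
    have "laplace_cdf \<epsilon> (- u - c) = 1 - laplace_cdf \<epsilon> (u + c)"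
      using laplace_cdf_minus[of \<epsilon> "u + c"] by simp
    then show "normal_density 0 \<sigma> (- u) * laplace_cdf \<epsilon> (- u - c) =
      normal_density 0 \<sigma> u - normal_density 0 \<sigma> u * laplace_cdf \<epsilon> (u + c)"
      by (simp only: right_diff_distrib mult_1_right) (simp add: normal_density_def)
  qed
  also have "\<dots> = 1 - A c"
    unfolding A_def using sigma_pos by (subst Bochner_Integration.integral_diff) auto
  finally show ?thesis .
qed

lemma A_mono: "c \<le> d \<Longrightarrow> A c \<le> A d"
  unfolding A_def using eps_pos
  by (intro integral_mono integrable_A mult_left_mono laplace_cdf_mono) auto

lemma A_shift: "h \<ge> 0 \<Longrightarrow> A (c + h) \<le> exp (\<epsilon> * h) * A c"
proof -
  assume h: "h \<ge> 0"
  have "A (c + h) \<le> (\<integral>u. exp (\<epsilon> * h) * (normal_density 0 \<sigma> u * laplace_cdf \<epsilon> (u + c)) \<partial>lborel)"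
    unfolding A_def
  proof (intro integral_mono integrable_A integrable_mult_right)
    fix u
    have "laplace_cdf \<epsilon> (u + (c + h)) \<le> exp (\<epsilon> * h) * laplace_cdf \<epsilon> (u + c)"
      using laplace_cdf_shift[OF eps_pos h, of "u + c"] by (simp add: add.assoc)
    from mult_left_mono[OF this, of "normal_density 0 \<sigma> u"]
    show "normal_density 0 \<sigma> u * laplace_cdf \<epsilon> (u + (c + h)) \<le>
      exp (\<epsilon> * h) * (normal_density 0 \<sigma> u * laplace_cdf \<epsilon> (u + c))"
      by (simp add: mult_ac)
  qed
  then show ?thesis by (simp add: A_def)
qed

text \<open>Half the moment generating function of the centred normal law at
  \<open>\<epsilon>\<close>; it is the constant in the exponential bound on
  \<open>A\<close>.\<close>

definition K :: real where "K = exp (\<epsilon>\<^sup>2 * \<sigma>\<^sup>2 / 2) / 2"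

lemma K_pos: "K > 0" by (simp add: K_def)

text \<open>Completing the square: exponential tilting moves the mean to
  \<open>\<epsilon> * \<sigma>\<^sup>2\<close>.\<close>

lemma normal_density_tilt:
  "normal_density 0 \<sigma> u * exp (\<epsilon> * u) = exp (\<epsilon>\<^sup>2 * \<sigma>\<^sup>2 / 2) * normal_density (\<epsilon> * \<sigma>\<^sup>2) \<sigma> u"
proof -
  have "- (u - 0)\<^sup>2 / (2 * \<sigma>\<^sup>2) + \<epsilon> * u
      = \<epsilon>\<^sup>2 * \<sigma>\<^sup>2 / 2 + - (u - \<epsilon> * \<sigma>\<^sup>2)\<^sup>2 / (2 * \<sigma>\<^sup>2)"
    using sigma_pos by (simp add: field_simps power2_eq_square)
  then show ?thesis
    unfolding normal_density_def by (simp add: mult_ac flip: exp_add)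
qed

lemma A_le_exp: "A c \<le> K * exp (\<epsilon> * c)"
proof -
  have "A c \<le> (\<integral>u. K * exp (\<epsilon> * c) * normal_density (\<epsilon> * \<sigma>\<^sup>2) \<sigma> u \<partial>lborel)"
    unfolding A_def
  proof (intro integral_mono integrable_A integrable_mult_right)
    fix u
    have "normal_density 0 \<sigma> u * laplace_cdf \<epsilon> (u + c) \<le> normal_density 0 \<sigma> u * (exp (\<epsilon> * (u + c)) / 2)"
      by (intro mult_left_mono laplace_cdf_le_exp) simp
    also have "\<dots> = (normal_density 0 \<sigma> u * exp (\<epsilon> * u)) * exp (\<epsilon> * c) / 2"
      by (simp add: distrib_left exp_add)
    also have "\<dots> = K * exp (\<epsilon> * c) * normal_density (\<epsilon> * \<sigma>\<^sup>2) \<sigma> u"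
      by (simp add: normal_density_tilt K_def)
    finally show "normal_density 0 \<sigma> u * laplace_cdf \<epsilon> (u + c) \<le> K * exp (\<epsilon> * c) * normal_density (\<epsilon> * \<sigma>\<^sup>2) \<sigma> u" .
  qed (use sigma_pos in simp)
  then show ?thesis using sigma_pos by simp
qed

text \<open>The two states remain distinguishable at the same exponential order as the upper bound
  \<open>A_le_exp\<close>. It suffices to integrate over a window of signals where both Laplace
  values are on the exponential branch.\<close>

lemma A_gap: "\<exists>k>0. \<forall>c\<le>0. A (c + 1) - A (c - 1) \<ge> k * exp (\<epsilon> * c)"
proof -
  \<comment> \<open>The factors are the least value of the density on \<open>{-2..-1}\<close> (at
    \<open>-2\<close>, equal to that at \<open>2\<close>), the difference of the Laplace values
    after factoring out \<open>exp (\<epsilon> * (u + c))\<close>, and the least value of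
    \<open>exp (\<epsilon> * u)\<close> on the window.\<close>
  define m where "m = normal_density 0 \<sigma> 2 * (exp \<epsilon> - exp (- \<epsilon>)) / 2 * exp (- 2 * \<epsilon>)"
  have m: "m > 0" using eps_pos sigma_pos by (simp add: m_def normal_density_pos)
  have "m * exp (\<epsilon> * c) \<le> A (c + 1) - A (c - 1)" if c: "c \<le> 0" for c
  proof -
    have "m * exp (\<epsilon> * c) = (\<integral>u. indicator {-2..-1::real} u * (m * exp (\<epsilon> * c)) \<partial>lborel)"
      by simp
    also have "\<dots> \<le> (\<integral>u. normal_density 0 \<sigma> u * laplace_cdf \<epsilon> (u + (c + 1)) -
         normal_density 0 \<sigma> u * laplace_cdf \<epsilon> (u + (c - 1)) \<partial>lborel)"
    proof (intro integral_mono Bochner_Integration.integrable_diff integrable_A)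
      fix u :: real
      show "indicator {-2..-1} u * (m * exp (\<epsilon> * c)) \<le> normal_density 0 \<sigma> u * laplace_cdf \<epsilon> (u + (c + 1)) -
         normal_density 0 \<sigma> u * laplace_cdf \<epsilon> (u + (c - 1))"
      proof (cases "u \<in> {-2..-1}")
        case True
        have sq: "u\<^sup>2 \<le> 2\<^sup>2"
          using True by (intro abs_le_square_iff[THEN iffD1]) auto
        have "normal_density 0 \<sigma> 2 \<le> normal_density 0 \<sigma> u"
          unfolding normal_density_def using divide_right_mono[OF sq, of "2 * \<sigma>\<^sup>2"]
          by (intro mult_left_mono) auto
        moreover have "exp (- 2 * \<epsilon>) \<le> exp (\<epsilon> * u)"
          using True eps_pos mult_left_mono[of "-2" u \<epsilon>] by auto
        moreover have "exp (- \<epsilon>) \<le> exp \<epsilon>" using eps_pos by simp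
        ultimately have "m * exp (\<epsilon> * c) \<le> normal_density 0 \<sigma> u * (exp \<epsilon> - exp (- \<epsilon>)) / 2 * exp (\<epsilon> * u) * exp (\<epsilon> * c)"
          unfolding m_def
          by (intro mult_right_mono mult_mono divide_right_mono) auto
        \<comment> \<open>Here \<open>u \<le> -1\<close> and \<open>c \<le> 0\<close> make
          \<open>u + (c + 1)\<close> and \<open>u + (c - 1)\<close> nonpositive, so both values are
          pure exponentials.\<close>
        also have "\<dots> = normal_density 0 \<sigma> u * (laplace_cdf \<epsilon> (u + (c + 1)) - laplace_cdf \<epsilon> (u + (c - 1)))"
          using True c
          by (simp add: laplace_cdf_def exp_add exp_diff exp_minus distrib_left right_diff_distrib diff_divide_distrib) (simp add: field_simps)
        finally show ?thesis using True by (simp add: right_diff_distrib)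
      next
        case False
        then show ?thesis using eps_pos
          by (simp add: mult_left_mono laplace_cdf_mono)
      qed
    qed simp
    also have "\<dots> = A (c + 1) - A (c - 1)"
      unfolding A_def by (rule Bochner_Integration.integral_diff[OF integrable_A integrable_A])
    finally show ?thesis .
  qed
  with m show ?thesis by blast
qed

lemma A_pos: "A c > 0"
proof -
  obtain k where k: "k > 0" "\<And>c. c \<le> 0 \<Longrightarrow> A (c + 1) - A (c - 1) \<ge> k * exp (\<epsilon> * c)"
    using A_gap by blast
  \<comment> \<open>This choice satisfies \<open>?d \<le> 0\<close>, where the gap applies, and
    \<open>?d + 1 \<le> c\<close>, where monotonicity takes over.\<close>
  let ?d = "min (c - 1) 0"
  have "A (?d - 1) \<ge> 0"
    unfolding A_def using laplace_cdf_pos[OF eps_pos]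
    by (intro Bochner_Integration.integral_nonneg mult_nonneg_nonneg) (auto intro: less_imp_le)
  moreover have "k * exp (\<epsilon> * ?d) > 0" using k by simp
  ultimately have "A (?d + 1) > 0" using k(2)[of ?d] by linarith
  also have "A (?d + 1) \<le> A c" by (intro A_mono) auto
  finally show ?thesis .
qed

lemma A_less_one: "A c < 1"
  using A_pos[of "- c"] by (simp add: A_minus)

end

text \<open>The arithmetic mean exceeds the geometric one by \<open>(p - q)\<^sup>2 / 2\<close> for
  the square roots \<open>p\<close> and \<open>q\<close>, while
  \<open>(p + q)\<^sup>2 \<le> 2 * (x + y)\<close> turns this into a bound by the squared difference
  of \<open>x\<close> and \<open>y\<close>.\<close>

lemma sqrt_mult_le_arith_mean_minus_gap:
  fixes x y :: real
  assumes "x > 0" "y > 0"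
  shows "sqrt (x * y) \<le> (x + y) / 2 - (x - y)\<^sup>2 / (4 * (x + y))"
proof -
  define p q where "p = sqrt x" and "q = sqrt y"
  have pq: "p > 0" "q > 0" "x = p\<^sup>2" "y = q\<^sup>2" using assms by (auto simp: p_def q_def)
  have "(x - y)\<^sup>2 = (p - q)\<^sup>2 * (p + q)\<^sup>2" by (simp add: pq power2_eq_square algebra_simps)
  also have "\<dots> \<le> (p - q)\<^sup>2 * (2 * (x + y))"
    using sum_squares_bound[of p q] by (intro mult_left_mono) (auto simp: pq power2_eq_square algebra_simps)
  finally have "(x - y)\<^sup>2 / (4 * (x + y)) \<le> (p - q)\<^sup>2 / 2"
    using assms by (simp add: field_simps)
  moreover have "sqrt (x * y) = p * q" by (simp add: p_def q_def real_sqrt_mult)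
  ultimately show ?thesis by (simp add: pq power2_eq_square field_simps)
qed

section \<open>Size and information content of a single report\<close>

context privacy_params
begin

definition a :: real where "a = \<epsilon> * \<sigma>\<^sup>2 / 2"

lemma a_pos: "a > 0" using eps_pos sigma_pos by (simp add: a_def)

abbreviation P :: "real \<Rightarrow> real \<Rightarrow> real" where "P \<equiv> prob_plus \<epsilon> \<sigma>"

lemma P_bounds: "0 < P l \<theta>" "P l \<theta> < 1" "0 \<le> P l \<theta>" "P l \<theta> \<le> 1"
  using A_pos A_less_one less_imp_le[OF A_pos] less_imp_le[OF A_less_one] by (auto simp: prob_plus_eq_A)

lemma one_minus_P: "1 - P l \<theta> = A (- \<theta> - \<sigma>\<^sup>2 * l / 2)"
  using A_minus[of "\<theta> + \<sigma>\<^sup>2 * l / 2"] by (simp add: prob_plus_eq_A)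

text \<open>The two states place the argument of \<open>A\<close> at distance 2, so monotonicity and
  \<open>A_shift\<close> with \<open>h = 2\<close> apply.\<close>

lemma P_ratio: "P l (-1) \<le> P l 1" "P l 1 \<le> exp (2 * \<epsilon>) * P l (-1)"
  using A_mono[of "-1 + \<sigma>\<^sup>2 * l / 2" "1 + \<sigma>\<^sup>2 * l / 2"] A_shift[of 2 "-1 + \<sigma>\<^sup>2 * l / 2"]
  by (auto simp: prob_plus_eq_A mult_ac)

lemma one_minus_P_ratio: "1 - P l 1 \<le> 1 - P l (-1)" "1 - P l (-1) \<le> exp (2 * \<epsilon>) * (1 - P l 1)"
  using P_ratio(1)[of l] A_shift[of 2 "-1 - \<sigma>\<^sup>2 * l / 2"]
  by (simp, simp only: one_minus_P, simp add: mult_ac)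

lemma llr_update_plus: "llr_update \<epsilon> \<sigma> l 1 = l + ln (P l 1 / P l (-1))"
  by (simp add: llr_update_def prob_report_def)

lemma llr_update_minus: "llr_update \<epsilon> \<sigma> l (-1) = l + ln ((1 - P l 1) / (1 - P l (-1)))"
  by (simp add: llr_update_def prob_report_def)

lemma llr_update_plus_bounds: "l \<le> llr_update \<epsilon> \<sigma> l 1" "llr_update \<epsilon> \<sigma> l 1 \<le> l + 2 * \<epsilon>"
proof -
  show "l \<le> llr_update \<epsilon> \<sigma> l 1"
    using P_ratio[of l] P_bounds[of l] by (simp add: llr_update_plus)
  have "ln (P l 1 / P l (-1)) \<le> ln (exp (2 * \<epsilon>))"
    using P_ratio[of l] P_bounds[of l] by (subst ln_le_cancel_iff) (auto simp: field_simps)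
  then show "llr_update \<epsilon> \<sigma> l 1 \<le> l + 2 * \<epsilon>" by (simp add: llr_update_plus)
qed

lemma llr_update_minus_bounds: "l - 2 * \<epsilon> \<le> llr_update \<epsilon> \<sigma> l (-1)" "llr_update \<epsilon> \<sigma> l (-1) \<le> l"
proof -
  have pos: "0 < 1 - P l 1" "0 < 1 - P l (-1)" using P_bounds[of l] by auto
  have "ln (1 - P l (-1)) \<le> ln (exp (2 * \<epsilon>) * (1 - P l 1))"
    using one_minus_P_ratio[of l] pos by (subst ln_le_cancel_iff) auto
  also have "\<dots> = 2 * \<epsilon> + ln (1 - P l 1)" using pos by (simp add: ln_mult)
  finally show "l - 2 * \<epsilon> \<le> llr_update \<epsilon> \<sigma> l (-1)"
    using pos by (simp add: llr_update_minus ln_div)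
  have "ln (1 - P l 1) \<le> ln (1 - P l (-1))"
    using one_minus_P_ratio[of l] pos by (subst ln_le_cancel_iff) auto
  then show "llr_update \<epsilon> \<sigma> l (-1) \<le> l"
    using pos by (simp add: llr_update_minus ln_div)
qed

definition B :: real where "B = (2 + 4 * \<epsilon>) * (K * exp \<epsilon>)"

lemma B_pos: "B > 0" using K_pos eps_pos by (simp add: B_def)

text \<open>The excess \<open>P l 1 - P l (-1)\<close> is at most the chance
  \<open>1 - P l (-1)\<close> of a report \<open>-1\<close> in the false state, which is at most
  \<open>Q\<close>. If this chance is at most one half, \<open>ln z \<le> z - 1\<close> gives
  \<open>2 * Q\<close>. Otherwise \<open>Q \<ge> 1/2\<close>, and the privacy bound
  \<open>2 * \<epsilon>\<close> is at most \<open>4 * \<epsilon> * Q\<close>. The constant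
  \<open>B\<close> adds the two cases.\<close>

lemma llr_update_plus_le: "llr_update \<epsilon> \<sigma> l 1 \<le> l + B * exp (- a * l)"
proof -
  define Q where "Q = K * exp \<epsilon> * exp (- a * l)"
  have Q: "1 - P l (-1) \<le> Q"
  proof -
    have "\<epsilon> * (1 - \<sigma>\<^sup>2 * l / 2) = \<epsilon> + - a * l" by (simp add: a_def algebra_simps)
    then have "A (1 - \<sigma>\<^sup>2 * l / 2) \<le> K * (exp \<epsilon> * exp (- a * l))"
      using A_le_exp[of "1 - \<sigma>\<^sup>2 * l / 2"] by (simp only: exp_add)
    then show ?thesis by (simp add: one_minus_P Q_def mult.assoc)
  qed
  have Q0: "Q \<ge> 0" using K_pos by (simp add: Q_def)
  have BQ: "B * exp (- a * l) = 2 * Q + 4 * \<epsilon> * Q" by (simp add: B_def Q_def algebra_simps)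
  show ?thesis
  proof (cases "1 - P l (-1) \<le> 1/2")
    case True
    have "ln (P l 1 / P l (-1)) \<le> P l 1 / P l (-1) - 1"
      using P_bounds by (intro ln_le_minus_one) simp
    also have "\<dots> = (P l 1 - P l (-1)) / P l (-1)" using P_bounds(1)[of l "-1"] by (simp add: diff_divide_distrib)
    also have "\<dots> \<le> Q / (1/2)"
      using True Q P_bounds[of l] P_ratio(1)[of l] by (intro frac_le) (auto intro: order_trans[OF _ Q])
    also have "\<dots> \<le> B * exp (- a * l)" unfolding BQ using Q0 eps_pos by simp
    finally show ?thesis by (simp add: llr_update_plus)
  next
    case False
    then have "1/2 \<le> Q" using Q by simp
    then have "4 * \<epsilon> * (1/2) \<le> 4 * \<epsilon> * Q" using eps_pos by (intro mult_left_mono) auto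
    then have "2 * \<epsilon> \<le> B * exp (- a * l)" unfolding BQ using Q0 by (simp add: mult_ac)
    then show ?thesis using llr_update_plus_bounds(2)[of l] by linarith
  qed
qed

text \<open>The information sits in the report that contradicts the belief. Its probabilities in the
  two states and their gap are all of order \<open>exp (- a * \<bar>l\<bar>)\<close>, hence so is
  the squared gap over the sum. The other report only needs the plain inequality of means.\<close>

lemma bhattacharyya_bound:
  "\<exists>\<kappa>>0. \<forall>l. sqrt (P l 1 * P l (-1)) + sqrt ((1 - P l 1) * (1 - P l (-1))) \<le> 1 - \<kappa> * exp (- a * \<bar>l\<bar>)"
proof -
  obtain k where k: "k > 0" "\<And>c. c \<le> 0 \<Longrightarrow> A (c + 1) - A (c - 1) \<ge> k * exp (\<epsilon> * c)"
    using A_gap by blast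
  \<comment> \<open>The square of the gap constant over 4 times the bound
    \<open>2 * (K * exp \<epsilon>)\<close> on the sum, both without their exponential
    factor.\<close>
  define \<kappa> where "\<kappa> = k\<^sup>2 / (8 * (K * exp \<epsilon>))"
  have \<kappa>: "\<kappa> > 0" using k(1) K_pos by (simp add: \<kappa>_def)
  have near: "sqrt (A (c + 1) * A (c - 1)) \<le> (A (c + 1) + A (c - 1)) / 2 - \<kappa> * exp (\<epsilon> * c)" if "c \<le> 0" for c
  proof -
    have "A (c + 1) + A (c - 1) \<le> 2 * A (c + 1)" using A_mono[of "c - 1" "c + 1"] by simp
    also have "\<dots> \<le> 2 * (K * exp \<epsilon> * exp (\<epsilon> * c))"
      using A_le_exp[of "c + 1"] by (simp add: distrib_left exp_add mult_ac)
    finally have s: "A (c + 1) + A (c - 1) \<le> 2 * (K * exp \<epsilon> * exp (\<epsilon> * c))" .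
    have "\<kappa> * exp (\<epsilon> * c) = (k * exp (\<epsilon> * c))\<^sup>2 / (4 * (2 * (K * exp \<epsilon> * exp (\<epsilon> * c))))"
      using K_pos by (simp add: \<kappa>_def power2_eq_square)
    also have "\<dots> \<le> (A (c + 1) - A (c - 1))\<^sup>2 / (4 * (A (c + 1) + A (c - 1)))"
      using k(1) k(2)[OF that] s A_pos[of "c+1"] A_pos[of "c-1"]
      by (intro frac_le power_mono) auto
    finally show ?thesis
      using sqrt_mult_le_arith_mean_minus_gap[OF A_pos[of "c+1"] A_pos[of "c-1"]] by linarith
  qed
  have far: "sqrt (A x * A y) \<le> (A x + A y) / 2" for x y
    using arith_geo_mean_sqrt[of "A x" "A y"] A_pos[of x] A_pos[of y] by simp
  have "sqrt (P l 1 * P l (-1)) + sqrt ((1 - P l 1) * (1 - P l (-1))) \<le> 1 - \<kappa> * exp (- a * \<bar>l\<bar>)" for l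
  proof -
    define b where "b = \<sigma>\<^sup>2 * l / 2"
    have bl: "\<epsilon> * b = a * l" by (simp add: b_def a_def)
    have eqs: "P l 1 = A (b + 1)" "P l (-1) = A (b - 1)" "1 - P l 1 = A (- b - 1)" "1 - P l (-1) = A (- b + 1)"
    proof -
      have "- 1 - b = - b - 1" by simp
      then show "1 - P l 1 = A (- b - 1)" by (simp only: one_minus_P b_def)
    next
      have "1 - b = - b + 1" by simp
      then show "1 - P l (-1) = A (- b + 1)" by (simp add: one_minus_P b_def)
    qed (simp_all add: prob_plus_eq_A b_def add.commute)
    have neg: "- (b + 1) = - b - 1" "- (b - 1) = - b + 1" by simp_all
    have sum: "A (- b - 1) = 1 - A (b + 1)" "A (- b + 1) = 1 - A (b - 1)"
      unfolding neg[symmetric] by (rule A_minus)+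
    \<comment> \<open>The arithmetic means of the two complementary pairs add up to 1, so only the
      remainders \<open>e1\<close> and \<open>e2\<close> survive.\<close>
    have combine: "X + Y \<le> 1 - e" if "X \<le> (u + u') / 2 - e1" "Y \<le> (w' + w) / 2 - e2"
      "w = 1 - u" "w' = 1 - u'" "e1 + e2 = e" for X Y u u' w w' e e1 e2 :: real
      using that by (simp add: field_simps)
    show ?thesis
    proof (cases "l \<ge> 0")
      case True
      then have "b \<ge> 0" by (simp add: b_def)
      then have *: "sqrt (A (- b - 1) * A (- b + 1)) \<le> (A (- b + 1) + A (- b - 1)) / 2 - \<kappa> * exp (- a * \<bar>l\<bar>)"
        using near[of "- b"] True bl by (simp add: mult.commute)
      have "sqrt (A (b + 1) * A (b - 1)) \<le> (A (b + 1) + A (b - 1)) / 2 - 0"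
        using far by simp
      then show ?thesis
        unfolding eqs(3,4) unfolding eqs(1,2) by (rule combine[OF _ * sum]) simp
    next
      case False
      then have "b \<le> 0" by (simp add: b_def mult_nonneg_nonpos)
      then have "sqrt (A (b + 1) * A (b - 1)) \<le> (A (b + 1) + A (b - 1)) / 2 - \<kappa> * exp (- a * \<bar>l\<bar>)"
        using near[of b] False bl by simp
      moreover have "sqrt (A (- b - 1) * A (- b + 1)) \<le> (A (- b + 1) + A (- b - 1)) / 2 - 0"
        using far[of "- b - 1" "- b + 1"] by (simp add: add.commute)
      ultimately show ?thesis
        unfolding eqs(3,4) unfolding eqs(1,2) by (rule combine[OF _ _ sum]) simp
    qed
  qed
  with \<kappa> show ?thesis by blast
qed

end

subsection \<open>Growth along a single path\<close>

lemma report_cases: "report \<epsilon> \<sigma> l x y = 1 \<or> report \<epsilon> \<sigma> l x y = -1"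
  by (auto simp: report_def intended_def)

lemma pub_llr_Suc:
  "n \<ge> 1 \<Longrightarrow> pub_llr \<epsilon> \<sigma> s v (Suc n) =
    llr_update \<epsilon> \<sigma> (pub_llr \<epsilon> \<sigma> s v n) (report \<epsilon> \<sigma> (pub_llr \<epsilon> \<sigma> s v n) (s n) (v n))"
  by (cases n) (auto simp: Let_def)

text \<open>The belief facing agent \<open>n\<close> depends only on earlier agents. This is the
  source of its independence from the signal and coin of agent \<open>n\<close>.\<close>

lemma pub_llr_cong:
  assumes "\<And>i. 1 \<le> i \<Longrightarrow> i < n \<Longrightarrow> s i = s' i \<and> v i = v' i"
  shows "pub_llr \<epsilon> \<sigma> s v n = pub_llr \<epsilon> \<sigma> s' v' n"
  using assms
proof (induction n)
  case (Suc n)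
  show ?case
  proof (cases "n \<ge> 1")
    case True
    have "pub_llr \<epsilon> \<sigma> s v n = pub_llr \<epsilon> \<sigma> s' v' n" using Suc by simp
    moreover have "s n = s' n" "v n = v' n" using Suc.prems[of n] True by auto
    ultimately show ?thesis by (simp only: pub_llr_Suc[OF True])
  qed (simp add: not_le)
qed simp

context privacy_params
begin

lemma llr_update_bounds:
  assumes "x = 1 \<or> x = -1"
  shows "\<bar>llr_update \<epsilon> \<sigma> l x - l\<bar> \<le> 2 * \<epsilon>" "llr_update \<epsilon> \<sigma> l x \<le> l + B * exp (- a * l)"
proof -
  have "0 < B * exp (- a * l)" using B_pos by simp
  then show "llr_update \<epsilon> \<sigma> l x \<le> l + B * exp (- a * l)"
    using assms llr_update_plus_le[of l] llr_update_minus_bounds[of l] by auto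
  show "\<bar>llr_update \<epsilon> \<sigma> l x - l\<bar> \<le> 2 * \<epsilon>"
    using assms llr_update_plus_bounds[of l] llr_update_minus_bounds[of l] eps_pos by auto
qed

text \<open>A deterministic bound, which makes all exponential moments of the belief finite.\<close>

lemma pub_llr_bounded: "\<bar>pub_llr \<epsilon> \<sigma> s v n\<bar> \<le> 2 * \<epsilon> * real n"
proof (induction n)
  case (Suc n)
  show ?case
  proof (cases "n \<ge> 1")
    case True
    show ?thesis
      using llr_update_bounds(1)[OF report_cases, of "pub_llr \<epsilon> \<sigma> s v n" \<epsilon> \<sigma> "pub_llr \<epsilon> \<sigma> s v n" "s n" "v n"] Suc
      by (simp add: pub_llr_Suc[OF True] distrib_left)
  qed (use eps_pos in \<open>simp add: not_le\<close>)
qed simp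

text \<open>On the scale \<open>exp (a * l)\<close> the upward step of order
  \<open>exp (- a * l)\<close> becomes a bounded increment, uniformly over all paths.\<close>

lemma exp_pub_llr_linear_growth:
  "\<exists>D>0. \<forall>s v n. exp (a * pub_llr \<epsilon> \<sigma> s v n) \<le> 1 + D * real n"
proof -
  \<comment> \<open>The first summand bounds the increment from \<open>l \<ge> 0\<close>, the second
    the value reached from a negative \<open>l\<close> by a step of at most
    \<open>2 * \<epsilon>\<close>.\<close>
  define D where "D = a * B * exp (a * B) + exp (2 * a * \<epsilon>)"
  have D: "D > 0" "exp (2 * a * \<epsilon>) \<le> D" "a * B * exp (a * B) \<le> D"
    using a_pos B_pos by (auto simp: D_def add_pos_pos)
  have step: "exp (a * llr_update \<epsilon> \<sigma> l x) \<le> max 1 (exp (a * l)) + D" if x: "x = 1 \<or> x = -1" for l x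
  proof (cases "l \<ge> 0")
    case True
    define t where "t = a * B * exp (- a * l)"
    have "exp (- a * l) \<le> exp 0" using True a_pos by (subst exp_le_cancel_iff) simp
    then have t: "0 \<le> t" "t \<le> a * B" using a_pos B_pos by (auto simp: t_def mult_left_le)
    have "1 - t \<le> exp (- t)" using exp_ge_add_one_self[of "- t"] by simp
    then have "(1 - t) * exp t \<le> exp (- t) * exp t" by (intro mult_right_mono) auto
    then have et: "exp t \<le> 1 + t * exp t" by (simp add: exp_minus algebra_simps)
    have "exp (a * llr_update \<epsilon> \<sigma> l x) \<le> exp (a * (l + B * exp (- a * l)))"
      using llr_update_bounds(2)[OF x] a_pos by simp
    also have "\<dots> = exp (a * l) * exp t" by (simp add: t_def distrib_left exp_add mult_ac)
    also have "\<dots> \<le> exp (a * l) * (1 + t * exp t)" using et by simp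
    also have "\<dots> = exp (a * l) + a * B * exp t"
      by (simp add: t_def algebra_simps exp_minus)
    also have "\<dots> \<le> exp (a * l) + a * B * exp (a * B)" using t a_pos B_pos by simp
    also have "\<dots> \<le> max 1 (exp (a * l)) + D" using D by simp
    finally show ?thesis .
  next
    case False
    then have "llr_update \<epsilon> \<sigma> l x \<le> 2 * \<epsilon>" using llr_update_bounds(1)[OF x, of l] by linarith
    then have "exp (a * llr_update \<epsilon> \<sigma> l x) \<le> exp (2 * a * \<epsilon>)" using a_pos by (simp add: mult_ac)
    then show ?thesis using D(2) by linarith
  qed
  have "exp (a * pub_llr \<epsilon> \<sigma> s v n) \<le> 1 + D * real n" for s v n
  proof (induction n)
    case (Suc n)
    show ?case
    proof (cases "n \<ge> 1")
      case True
      have "exp (a * pub_llr \<epsilon> \<sigma> s v (Suc n)) \<le> max 1 (exp (a * pub_llr \<epsilon> \<sigma> s v n)) + D"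
        unfolding pub_llr_Suc[OF True] by (intro step report_cases)
      also have "\<dots> \<le> (1 + D * real n) + D"
        using Suc mult_nonneg_nonneg[of D "real n"] D(1) by (intro add_right_mono max.boundedI) auto
      finally show ?thesis by (simp add: algebra_simps)
    next
      case False
      then have "n = 0" by simp
      then show ?thesis using D(1) by simp
    qed
  qed simp
  with D(1) show ?thesis by blast
qed

section \<open>Measurability of the belief process\<close>

lemma borel_measurable_P [measurable]: "(\<lambda>l. P l \<theta>) \<in> borel_measurable borel"
proof -
  \<comment> \<open>Monotone real functions are Borel, which avoids measurability of a parametrised
    integral.\<close>
  have A: "A \<in> borel_measurable borel" by (intro borel_measurable_mono monoI A_mono)
  show ?thesis unfolding prob_plus_eq_A by (rule measurable_compose[OF _ A]) simp
qed

lemma borel_measurable_llr_update [measurable (raw)]: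
  assumes [measurable]: "f \<in> borel_measurable N" "g \<in> borel_measurable N"
  shows "(\<lambda>x. llr_update \<epsilon> \<sigma> (f x) (g x)) \<in> borel_measurable N"
  unfolding llr_update_def prob_report_def by measurable

lemma borel_measurable_report [measurable (raw)]:
  assumes [measurable]: "f \<in> borel_measurable N" "g \<in> borel_measurable N" "h \<in> borel_measurable N"
  shows "(\<lambda>x. report \<epsilon> \<sigma> (f x) (g x) (h x)) \<in> borel_measurable N"
  unfolding report_def intended_def flip_prob_def thr_def by measurable

lemma borel_measurable_pub_llr:
  assumes "\<And>i. 1 \<le> i \<Longrightarrow> i < n \<Longrightarrow> s i \<in> borel_measurable N \<and> v i \<in> borel_measurable N"
  shows "(\<lambda>x. pub_llr \<epsilon> \<sigma> (\<lambda>i. s i x) (\<lambda>i. v i x) n) \<in> borel_measurable N"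
  using assms
proof (induction n)
  case (Suc n)
  show ?case
  proof (cases "n \<ge> 1")
    case True
    then have [measurable]: "s n \<in> borel_measurable N" "v n \<in> borel_measurable N"
      using Suc.prems by auto
    have [measurable]: "(\<lambda>x. pub_llr \<epsilon> \<sigma> (\<lambda>i. s i x) (\<lambda>i. v i x) n) \<in> borel_measurable N"
      using Suc by auto
    show ?thesis unfolding pub_llr_Suc[OF True] by measurable
  qed (simp add: not_le)
qed simp

section \<open>Law of one signal together with its coin\<close>

definition uniform_coin :: "real measure" where
  "uniform_coin = density lborel (\<lambda>x. ennreal (indicator {0..1} x / measure lborel {0..(1::real)}))"

text \<open>The definition copies the density in the hypothesis on the coins; this form is
  convenient for computing probabilities.\<close>

lemma uniform_coin_eq: "uniform_coin = uniform_measure lborel {0..1}"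
  unfolding uniform_coin_def uniform_measure_def
  by (intro arg_cong2[where f = density] refl ext) (auto simp: indicator_def)

lemma sets_uniform_coin [measurable_cong]: "sets uniform_coin = sets borel"
  by (simp add: uniform_coin_def)

lemma prob_space_uniform_coin: "prob_space uniform_coin"
  unfolding uniform_coin_eq by (rule prob_space_uniform_measure) auto

lemma measure_uniform_coin_less:
  assumes "0 \<le> u" "u \<le> 1"
  shows "measure uniform_coin {..<u} = u"
proof -
  have "{0..1} \<inter> {..<u} = {0..<u}" using assms by auto
  then show ?thesis
    unfolding uniform_coin_eq using assms by (subst measure_uniform_measure) auto
qed

lemma flip_prob_bounds: "0 \<le> flip_prob \<epsilon> \<sigma> l x" "flip_prob \<epsilon> \<sigma> l x \<le> 1"
proof -
  have "exp (- \<epsilon> * \<bar>x - thr \<sigma> l\<bar>) \<le> 1" using eps_pos by simp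
  then have "exp (- \<epsilon> * \<bar>x - thr \<sigma> l\<bar>) / 2 \<le> 1" by linarith
  then show "flip_prob \<epsilon> \<sigma> l x \<le> 1" by (simp add: flip_prob_def)
qed (simp add: flip_prob_def)

lemma integral_report_coin:
  "(\<integral>y. of_bool (report \<epsilon> \<sigma> l x y = 1) \<partial>uniform_coin) =
    (if x > thr \<sigma> l then 1 - flip_prob \<epsilon> \<sigma> l x else flip_prob \<epsilon> \<sigma> l x)"
proof -
  interpret U: prob_space uniform_coin by (rule prob_space_uniform_coin)
  let ?u = "flip_prob \<epsilon> \<sigma> l x"
  have [simp]: "integrable uniform_coin (\<lambda>y. indicator {..<?u} y :: real)"
    by (intro U.integrable_const_bound[of _ 1]) (auto simp: indicator_def)
  have "(of_bool (report \<epsilon> \<sigma> l x y = 1) :: real) =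
      (if x > thr \<sigma> l then 1 - indicator {..<?u} y else indicator {..<?u} y)" for y
    by (auto simp: report_def intended_def indicator_def)
  then show ?thesis
    using measure_uniform_coin_less[OF flip_prob_bounds, of l x] by (auto simp: U.prob_space)
qed

definition signal_coin :: "(real \<times> real) measure" where
  "signal_coin = density lborel (normal_density 1 \<sigma>) \<Otimes>\<^sub>M uniform_coin"

text \<open>Integrating out the coin first leaves exactly the integrand of \<open>prob_plus\<close>.
  Thus reports generated by coins follow the law that the Bayesian update assumes in state
  \<open>+1\<close>.\<close>

lemma integral_report_signal_coin:
  "(\<integral>z. of_bool (report \<epsilon> \<sigma> l (fst z) (snd z) = 1) \<partial>signal_coin) = P l 1"
proof -
  interpret U: prob_space uniform_coin by (rule prob_space_uniform_coin)
  interpret S: prob_space "density lborel (normal_density 1 \<sigma>)"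
    by (rule prob_space_normal_density[OF sigma_pos])
  interpret SU: pair_prob_space "density lborel (normal_density 1 \<sigma>)" uniform_coin ..
  let ?f = "\<lambda>z. of_bool (report \<epsilon> \<sigma> l (fst z) (snd z) = 1) :: real"
  have "integrable (density lborel (normal_density 1 \<sigma>) \<Otimes>\<^sub>M uniform_coin) ?f"
    by (intro SU.integrable_const_bound[of _ 1]) auto
  from SU.integral_fst'[OF this, symmetric]
  have "(\<integral>z. ?f z \<partial>signal_coin) =
     (\<integral>x. \<integral>y. of_bool (report \<epsilon> \<sigma> l x y = 1) \<partial>uniform_coin \<partial>density lborel (normal_density 1 \<sigma>))"
    by (simp add: signal_coin_def)
  also have "\<dots> = P l 1"
  proof -
    have [measurable]: "(\<lambda>x. flip_prob \<epsilon> \<sigma> l x) \<in> borel_measurable borel"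
      unfolding flip_prob_def by measurable
    show ?thesis
      unfolding integral_report_coin prob_plus_def by (subst integral_density) auto
  qed
  finally show ?thesis .
qed

end

subsection \<open>Conditional law of a report\<close>

text \<open>Conditioning on the state \<open>+1\<close> is expressed by signals of mean 1. In the
  joint family \<open>(True, i)\<close> indexes signals and \<open>(False, i)\<close> coins.\<close>

locale gaussian_learning = privacy_params \<epsilon> \<sigma> + prob_space M
  for \<epsilon> \<sigma> :: real and M :: "'w measure" +
  fixes s v :: "nat \<Rightarrow> 'w \<Rightarrow> real"
  assumes signal: "\<And>i. i \<ge> 1 \<Longrightarrow> distributed M lborel (s i) (normal_density 1 \<sigma>)"
    and coin: "\<And>i. i \<ge> 1 \<Longrightarrow>
      distributed M lborel (v i) (\<lambda>x. indicator {0..1} x / measure lborel {0..(1::real)})"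
    and indep: "indep_vars (\<lambda>_. borel) (\<lambda>(b, i). if b then s i else v i) (UNIV \<times> {1..})"
begin

abbreviation L :: "nat \<Rightarrow> 'w \<Rightarrow> real" where
  "L n \<omega> \<equiv> pub_llr \<epsilon> \<sigma> (\<lambda>i. s i \<omega>) (\<lambda>i. v i \<omega>) n"

abbreviation history_index :: "nat \<Rightarrow> (bool \<times> nat) set" where
  "history_index n \<equiv> UNIV \<times> {1..<n}"

abbreviation history_space :: "nat \<Rightarrow> (bool \<times> nat \<Rightarrow> real) measure" where
  "history_space n \<equiv> PiM (history_index n) (\<lambda>_. borel)"

definition history :: "nat \<Rightarrow> 'w \<Rightarrow> bool \<times> nat \<Rightarrow> real" where
  "history n \<omega> = restrict (\<lambda>(b, i). if b then s i \<omega> else v i \<omega>) (history_index n)"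

text \<open>The belief as a function on the product space of past inputs, so that conditioning on
  the past becomes integration against a product measure.\<close>

definition history_llr :: "nat \<Rightarrow> (bool \<times> nat \<Rightarrow> real) \<Rightarrow> real" where
  "history_llr m x = pub_llr \<epsilon> \<sigma> (\<lambda>i. x (True, i)) (\<lambda>i. x (False, i)) m"

lemma history_llr_history: "m \<le> n \<Longrightarrow> history_llr m (history n \<omega>) = L m \<omega>"
  unfolding history_llr_def by (rule pub_llr_cong) (auto simp: history_def)

lemma borel_measurable_history_llr:
  "m \<le> n \<Longrightarrow> history_llr m \<in> borel_measurable (history_space n)"
  unfolding history_llr_def[abs_def]
  by (rule borel_measurable_pub_llr) (auto intro!: measurable_component_singleton)

lemma borel_measurable_signal [measurable]: "i \<ge> 1 \<Longrightarrow> s i \<in> borel_measurable M"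
  using distributed_measurable[OF signal] by simp

lemma borel_measurable_coin [measurable]: "i \<ge> 1 \<Longrightarrow> v i \<in> borel_measurable M"
  using distributed_measurable[OF coin] by simp

lemma borel_measurable_L [measurable]: "L n \<in> borel_measurable M"
  by (rule borel_measurable_pub_llr) auto

lemma integrable_exp_L [simp]: "integrable M (\<lambda>\<omega>. exp (t * L n \<omega>))"
proof (rule integrable_const_bound[of _ "exp (\<bar>t\<bar> * (2 * \<epsilon> * real n))"])
  show "AE \<omega> in M. norm (exp (t * L n \<omega>)) \<le> exp (\<bar>t\<bar> * (2 * \<epsilon> * real n))"
  proof (rule AE_I2)
    fix \<omega>
    have "t * L n \<omega> \<le> \<bar>t\<bar> * \<bar>L n \<omega>\<bar>" by (simp flip: abs_mult)
    also have "\<dots> \<le> \<bar>t\<bar> * (2 * \<epsilon> * real n)" by (intro mult_left_mono pub_llr_bounded) simp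
    finally show "norm (exp (t * L n \<omega>)) \<le> exp (\<bar>t\<bar> * (2 * \<epsilon> * real n))" by simp
  qed
qed simp

lemma distr_signal_coin:
  assumes n: "n \<ge> 1"
  shows "distr M (borel \<Otimes>\<^sub>M borel) (\<lambda>\<omega>. (s n \<omega>, v n \<omega>)) = signal_coin"
proof -
  let ?X = "\<lambda>(b, i). if b then s i else v i"
  have "indep_var (PiM {(True, n)} (\<lambda>_. borel)) (\<lambda>\<omega>. restrict (\<lambda>j. ?X j \<omega>) {(True, n)})
          (PiM {(False, n)} (\<lambda>_. borel)) (\<lambda>\<omega>. restrict (\<lambda>j. ?X j \<omega>) {(False, n)})"
    using n by (intro indep_var_restrict[OF indep]) auto
  then have "indep_var borel ((\<lambda>x. x (True, n)) \<circ> (\<lambda>\<omega>. restrict (\<lambda>j. ?X j \<omega>) {(True, n)}))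
          borel ((\<lambda>x. x (False, n)) \<circ> (\<lambda>\<omega>. restrict (\<lambda>j. ?X j \<omega>) {(False, n)}))"
    by (rule indep_var_compose) (auto intro!: measurable_component_singleton)
  then have "indep_var borel (s n) borel (v n)" by (simp add: comp_def)
  then have "distr M (borel \<Otimes>\<^sub>M borel) (\<lambda>\<omega>. (s n \<omega>, v n \<omega>)) = distr M borel (s n) \<Otimes>\<^sub>M distr M borel (v n)"
    by (simp add: indep_var_distribution_eq)
  also have "distr M borel (s n) = density lborel (normal_density 1 \<sigma>)"
    using distributed_distr_eq_density[OF signal[OF n]] by (simp cong: distr_cong)
  also have "distr M borel (v n) = uniform_coin"
    using distributed_distr_eq_density[OF coin[OF n]] by (simp add: uniform_coin_def cong: distr_cong)
  finally show ?thesis by (simp add: signal_coin_def)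
qed

lemma random_variable_history [measurable]: "history n \<in> measurable M (history_space n)"
  unfolding history_def[abs_def]
  by (intro measurable_restrict) auto

definition fresh :: "nat \<Rightarrow> 'w \<Rightarrow> bool \<times> nat \<Rightarrow> real" where
  "fresh n \<omega> = restrict (\<lambda>(b, i). if b then s i \<omega> else v i \<omega>) (UNIV \<times> {n})"

lemma random_variable_fresh [measurable]:
  "n \<ge> 1 \<Longrightarrow> fresh n \<in> measurable M (PiM (UNIV \<times> {n}) (\<lambda>_. borel))"
  unfolding fresh_def[abs_def] by (intro measurable_restrict) auto

text \<open>The index blocks of the past and of agent \<open>n\<close> are disjoint, and disjoint
  blocks of an independent family are independent.\<close>

lemma distr_history_fresh:
  assumes n: "n \<ge> 1"
  shows "distr M (history_space n \<Otimes>\<^sub>M PiM (UNIV \<times> {n}) (\<lambda>_. borel)) (\<lambda>\<omega>. (history n \<omega>, fresh n \<omega>))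
    = distr M (history_space n) (history n) \<Otimes>\<^sub>M distr M (PiM (UNIV \<times> {n}) (\<lambda>_. borel)) (fresh n)"
proof -
  let ?X = "\<lambda>(b, i). if b then s i else v i"
  let ?B = "UNIV \<times> {n} :: (bool \<times> nat) set"
  have "indep_var (history_space n) (\<lambda>\<omega>. restrict (\<lambda>j. ?X j \<omega>) (history_index n))
          (PiM ?B (\<lambda>_. borel)) (\<lambda>\<omega>. restrict (\<lambda>j. ?X j \<omega>) ?B)"
    using n by (intro indep_var_restrict[OF indep]) auto
  also have "(\<lambda>\<omega>. restrict (\<lambda>j. ?X j \<omega>) (history_index n)) = history n"
    by (auto simp: history_def fun_eq_iff restrict_def)
  also have "(\<lambda>\<omega>. restrict (\<lambda>j. ?X j \<omega>) ?B) = fresh n"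
    by (auto simp: fresh_def fun_eq_iff restrict_def)
  finally show ?thesis by (simp add: indep_var_distribution_eq)
qed

abbreviation R :: "nat \<Rightarrow> 'w \<Rightarrow> real" where
  "R n \<omega> \<equiv> report \<epsilon> \<sigma> (L n \<omega>) (s n \<omega>) (v n \<omega>)"

lemma prob_report_fresh:
  assumes n: "n \<ge> 1"
  shows "(\<integral>z. of_bool (report \<epsilon> \<sigma> l (z (True, n)) (z (False, n)) = 1)
    \<partial>distr M (PiM (UNIV \<times> {n}) (\<lambda>_. borel)) (fresh n)) = P l 1" (is "?lhs = _")
proof -
  have [measurable]: "s n \<in> borel_measurable M" "v n \<in> borel_measurable M" using n by auto
  have "?lhs = (\<integral>\<omega>. of_bool (report \<epsilon> \<sigma> l (fresh n \<omega> (True, n)) (fresh n \<omega> (False, n)) = 1) \<partial>M)"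
    by (rule integral_distr) (use n in measurable)
  also have "\<dots> = (\<integral>\<omega>. of_bool (report \<epsilon> \<sigma> l (fst (s n \<omega>, v n \<omega>)) (snd (s n \<omega>, v n \<omega>)) = 1) \<partial>M)"
    by (simp add: fresh_def)
  also have "\<dots> = (\<integral>z. of_bool (report \<epsilon> \<sigma> l (fst z) (snd z) = 1)
      \<partial>distr M (borel \<Otimes>\<^sub>M borel) (\<lambda>\<omega>. (s n \<omega>, v n \<omega>)))"
    by (rule integral_distr[symmetric]) measurable
  also have "\<dots> = P l 1" by (simp only: distr_signal_coin[OF n] integral_report_signal_coin)
  finally show ?thesis .
qed

text \<open>Says that \<open>P (L n) 1\<close> is the conditional probability of a report
  \<open>+1\<close> given the past, in a form tested against bounded functions \<open>g\<close> of
  the history. By the product law, Fubini allows the fresh inputs to be integrated first with the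
  past frozen.\<close>

lemma expectation_report:
  fixes g :: "(bool \<times> nat \<Rightarrow> real) \<Rightarrow> real"
  assumes n: "n \<ge> 1" and g [measurable]: "g \<in> borel_measurable (history_space n)"
    and bound: "\<And>x. \<bar>g x\<bar> \<le> C"
  shows "(\<integral>\<omega>. g (history n \<omega>) * of_bool (R n \<omega> = 1) \<partial>M) = (\<integral>\<omega>. g (history n \<omega>) * P (L n \<omega>) 1 \<partial>M)"
proof -
  let ?S = "PiM (UNIV \<times> {n}) (\<lambda>_. borel) :: (bool \<times> nat \<Rightarrow> real) measure"
  let ?H = "distr M (history_space n) (history n)"
  let ?N = "distr M ?S (fresh n)"
  have [measurable]: "fresh n \<in> measurable M ?S" using n by simp
  interpret H: prob_space ?H by (rule prob_space_distr) measurable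
  interpret N: prob_space ?N by (rule prob_space_distr) measurable
  interpret HN: pair_prob_space ?H ?N ..
  have [measurable]: "history_llr n \<in> borel_measurable (history_space n)"
    by (rule borel_measurable_history_llr) simp
  let ?F = "\<lambda>(x, z). g x * of_bool (report \<epsilon> \<sigma> (history_llr n x) (z (True, n)) (z (False, n)) = 1)"
  have F [measurable]: "?F \<in> borel_measurable (history_space n \<Otimes>\<^sub>M ?S)"
    by measurable
  have F': "?F \<in> borel_measurable (?H \<Otimes>\<^sub>M ?N)" by measurable
  have int: "integrable (?H \<Otimes>\<^sub>M ?N) ?F"
    using bound order_trans[OF abs_ge_zero bound]
    by (intro HN.integrable_const_bound[OF _ F', of C]) (auto simp: abs_mult split: split_of_bool)
  have "(\<integral>\<omega>. g (history n \<omega>) * of_bool (R n \<omega> = 1) \<partial>M) = (\<integral>\<omega>. ?F (history n \<omega>, fresh n \<omega>) \<partial>M)"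
    by (simp add: history_llr_history fresh_def)
  also have "\<dots> = (\<integral>y. ?F y \<partial>distr M (history_space n \<Otimes>\<^sub>M ?S) (\<lambda>\<omega>. (history n \<omega>, fresh n \<omega>)))"
    by (rule integral_distr[symmetric]) measurable
  also have "\<dots> = (\<integral>y. ?F y \<partial>(?H \<Otimes>\<^sub>M ?N))"
    by (simp only: distr_history_fresh[OF n])
  also have "\<dots> = (\<integral>x. (\<integral>z. ?F (x, z) \<partial>?N) \<partial>?H)"
    by (rule HN.integral_fst'[OF int, symmetric])
  also have "\<dots> = (\<integral>x. g x * P (history_llr n x) 1 \<partial>?H)"
    by (simp add: prob_report_fresh[OF n])
  also have "\<dots> = (\<integral>\<omega>. g (history n \<omega>) * P (history_llr n (history n \<omega>)) 1 \<partial>M)"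
    by (rule integral_distr) measurable
  finally show ?thesis by (simp add: history_llr_history)
qed

end

subsection \<open>Decay of the expected root likelihood ratio\<close>

text \<open>Discrete version of the equation \<open>m' = - c * m powr (1 + r)\<close>: the quantity
  \<open>m n powr (- r)\<close> grows by at least \<open>r * c\<close> in each step.\<close>

lemma power_decay_from_recursion:
  fixes m :: "nat \<Rightarrow> real"
  assumes c: "c > 0" and r: "r > 0" and pos: "\<And>n. n \<ge> 1 \<Longrightarrow> m n > 0"
    and rec: "\<And>n. n \<ge> 1 \<Longrightarrow> m (Suc n) \<le> m n - c * m n powr (1 + r)"
  shows "\<exists>C>0. \<forall>n\<ge>1. m n \<le> C * real n powr (- (1 / r))"
proof -
  have step: "m n powr (- r) + r * c \<le> m (Suc n) powr (- r)" if n: "n \<ge> 1" for n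
  proof -
    \<comment> \<open>The relative decrease, so the recursion reads
      \<open>m (Suc n) \<le> m n * (1 - x)\<close>; positivity of the next term forces
      \<open>x < 1\<close>.\<close>
    define x where "x = c * m n powr r"
    have x: "x > 0" using c pos[OF n] by (simp add: x_def)
    have le: "m (Suc n) \<le> m n * (1 - x)"
      using rec[OF n] pos[OF n] by (simp add: x_def powr_add algebra_simps)
    then have "0 < m n * (1 - x)" using pos[of "Suc n"] by linarith
    then have x1: "x < 1" using pos[OF n] by (simp add: zero_less_mult_iff)
    have "1 + r * x \<le> exp (r * x)" by (rule exp_ge_add_one_self)
    also have "\<dots> \<le> exp (- r * ln (1 - x))"
      using ln_le_minus_one[of "1 - x"] x1 r mult_left_mono[of "x" "- ln (1 - x)" r] by simp
    also have "\<dots> = (1 - x) powr (- r)" using x1 by (simp add: powr_def)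
    finally have "m n powr (- r) * (1 + r * x) \<le> m n powr (- r) * (1 - x) powr (- r)"
      by (intro mult_left_mono) auto
    also have "\<dots> = (m n * (1 - x)) powr (- r)"
      using pos[OF n] x1 by (simp add: powr_mult)
    also have "\<dots> \<le> m (Suc n) powr (- r)"
      using le pos[of "Suc n"] r by (intro powr_mono2') auto
    finally have "m n powr (- r) * (1 + r * x) \<le> m (Suc n) powr (- r)" .
    moreover have "m n powr (- r) * x = c" using pos[OF n] by (simp add: x_def powr_minus field_simps)
    then have "m n powr (- r) * (1 + r * x) = m n powr (- r) + r * c" by (simp add: algebra_simps)
    ultimately show ?thesis by simp
  qed
  \<comment> \<open>The second entry of the minimum starts the induction at \<open>n = 1\<close>,
    the first carries the step.\<close>
  define \<kappa> where "\<kappa> = min (r * c) (m 1 powr (- r))"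
  have \<kappa>: "\<kappa> > 0" using r c pos[of 1] by (simp add: \<kappa>_def)
  have lin: "\<kappa> * real n \<le> m n powr (- r)" if "n \<ge> 1" for n
    using that
  proof (induction n rule: dec_induct)
    case (step n)
    have "\<kappa> \<le> r * c" by (simp add: \<kappa>_def)
    with step.IH \<open>n \<ge> 1\<close> \<open>\<And>n. n \<ge> 1 \<Longrightarrow> m n powr (- r) + r * c \<le> m (Suc n) powr (- r)\<close>[of n]
    show ?case by (simp add: distrib_left)
  qed (simp add: \<kappa>_def)
  have "m n \<le> \<kappa> powr (- (1 / r)) * real n powr (- (1 / r))" if n: "n \<ge> 1" for n
  proof -
    have "m n = (m n powr (- r)) powr (- (1 / r))"
      using pos[OF n] r by (simp add: powr_powr)
    also have "\<dots> \<le> (\<kappa> * real n) powr (- (1 / r))"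
      using lin[OF n] \<kappa> n r by (intro powr_mono2') auto
    finally show ?thesis using \<kappa> by (simp add: powr_mult)
  qed
  then show ?thesis using \<kappa> by (intro exI[of _ "\<kappa> powr (- (1 / r))"]) auto
qed

section \<open>One-step evolution of exponential moments\<close>

context gaussian_learning
begin

lemma expectation_exp_step:
  fixes g :: "(bool \<times> nat \<Rightarrow> real) \<Rightarrow> real"
  assumes n: "n \<ge> 1" and g [measurable]: "g \<in> borel_measurable (history_space n)"
    and bound: "\<And>x. \<bar>g x\<bar> \<le> C"
  shows "(\<integral>\<omega>. g (history n \<omega>) * exp (t * L (Suc n) \<omega>) \<partial>M) =
    (\<integral>\<omega>. g (history n \<omega>) * (P (L n \<omega>) 1 * exp (t * llr_update \<epsilon> \<sigma> (L n \<omega>) 1) +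
       (1 - P (L n \<omega>) 1) * exp (t * llr_update \<epsilon> \<sigma> (L n \<omega>) (-1))) \<partial>M)"
proof -
  have [measurable]: "history_llr n \<in> borel_measurable (history_space n)"
    by (rule borel_measurable_history_llr) simp
  have [measurable]: "s n \<in> borel_measurable M" "v n \<in> borel_measurable M" using n by auto
  have C: "C \<ge> 0" using bound[of undefined] by linarith
  \<comment> \<open>The integrand with the report frozen at \<open>y\<close>. It depends on the past
    alone, so \<open>expectation_report\<close> applies to it.\<close>
  define h where "h y x = g x * exp (t * llr_update \<epsilon> \<sigma> (history_llr n x) y)" for y x
  have h [measurable]: "h y \<in> borel_measurable (history_space n)" for y
    unfolding h_def[abs_def] by measurable
  define E where "E = C * exp (\<bar>t\<bar> * (2 * \<epsilon> * real n + 2 * \<epsilon>))"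
  have hb: "\<bar>h y x\<bar> \<le> E" if y: "y = 1 \<or> y = -1" for y x
  proof -
    have "\<bar>llr_update \<epsilon> \<sigma> (history_llr n x) y\<bar> \<le> 2 * \<epsilon> * real n + 2 * \<epsilon>"
      using llr_update_bounds(1)[OF y, of "history_llr n x"]
        pub_llr_bounded[of "\<lambda>i. x (True, i)" "\<lambda>i. x (False, i)" n]
      unfolding history_llr_def by linarith
    then have "\<bar>t\<bar> * \<bar>llr_update \<epsilon> \<sigma> (history_llr n x) y\<bar> \<le> \<bar>t\<bar> * (2 * \<epsilon> * real n + 2 * \<epsilon>)"
      by (intro mult_left_mono) auto
    then have "t * llr_update \<epsilon> \<sigma> (history_llr n x) y \<le> \<bar>t\<bar> * (2 * \<epsilon> * real n + 2 * \<epsilon>)"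
      by (simp flip: abs_mult)
    then show ?thesis
      unfolding h_def E_def abs_mult using bound C by (intro mult_mono) auto
  qed
  have E: "E \<ge> 0" using C by (simp add: E_def)
  have integ: "integrable M (\<lambda>\<omega>. h y (history n \<omega>) * f \<omega>)"
    if "y = 1 \<or> y = -1" and [measurable]: "f \<in> borel_measurable M" and "\<And>\<omega>. \<bar>f \<omega>\<bar> \<le> 1" for y f
  proof (rule integrable_const_bound[of _ E])
    show "AE \<omega> in M. norm (h y (history n \<omega>) * f \<omega>) \<le> E"
      using mult_mono[OF hb[OF that(1)] that(3) E] by (simp add: abs_mult)
  qed measurable
  have split3: "(\<integral>\<omega>. f1 \<omega> + (f2 \<omega> - f3 \<omega>) \<partial>M) = (\<integral>\<omega>. f1 \<omega> \<partial>M) + ((\<integral>\<omega>. f2 \<omega> \<partial>M) - (\<integral>\<omega>. f3 \<omega> \<partial>M))"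
    if "integrable M f1" "integrable M f2" "integrable M f3" for f1 f2 f3 :: "'w \<Rightarrow> real"
    using that by simp
  have Pb: "\<bar>P l 1\<bar> \<le> 1" "\<bar>1 - P l 1\<bar> \<le> 1" for l using P_bounds[of l 1] by auto
  have "(\<integral>\<omega>. g (history n \<omega>) * exp (t * L (Suc n) \<omega>) \<partial>M) =
    (\<integral>\<omega>. h 1 (history n \<omega>) * of_bool (R n \<omega> = 1) +
      (h (-1) (history n \<omega>) * 1 - h (-1) (history n \<omega>) * of_bool (R n \<omega> = 1)) \<partial>M)"
  proof (rule Bochner_Integration.integral_cong[OF refl])
    fix \<omega>
    show "g (history n \<omega>) * exp (t * L (Suc n) \<omega>) = h 1 (history n \<omega>) * of_bool (R n \<omega> = 1) +
      (h (-1) (history n \<omega>) * 1 - h (-1) (history n \<omega>) * of_bool (R n \<omega> = 1))"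
      using report_cases[of \<epsilon> \<sigma> "L n \<omega>" "s n \<omega>" "v n \<omega>"]
      by (auto simp: h_def history_llr_history pub_llr_Suc[OF n])
  qed
  also have "\<dots> = (\<integral>\<omega>. h 1 (history n \<omega>) * of_bool (R n \<omega> = 1) \<partial>M) +
      ((\<integral>\<omega>. h (-1) (history n \<omega>) * 1 \<partial>M) - (\<integral>\<omega>. h (-1) (history n \<omega>) * of_bool (R n \<omega> = 1) \<partial>M))"
    by (intro split3 integ) auto
  also have "\<dots> = (\<integral>\<omega>. h 1 (history n \<omega>) * P (L n \<omega>) 1 \<partial>M) +
      ((\<integral>\<omega>. h (-1) (history n \<omega>) * 1 \<partial>M) - (\<integral>\<omega>. h (-1) (history n \<omega>) * P (L n \<omega>) 1 \<partial>M))"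
    using expectation_report[OF n h hb, of 1] expectation_report[OF n h hb, of "-1"] by simp
  also have "\<dots> = (\<integral>\<omega>. h 1 (history n \<omega>) * P (L n \<omega>) 1 +
      (h (-1) (history n \<omega>) * 1 - h (-1) (history n \<omega>) * P (L n \<omega>) 1) \<partial>M)"
    by (intro split3[symmetric] integ Pb) auto
  also have "\<dots> = (\<integral>\<omega>. g (history n \<omega>) * (P (L n \<omega>) 1 * exp (t * llr_update \<epsilon> \<sigma> (L n \<omega>) 1) +
       (1 - P (L n \<omega>) 1) * exp (t * llr_update \<epsilon> \<sigma> (L n \<omega>) (-1))) \<partial>M)"
    by (intro Bochner_Integration.integral_cong refl) (simp add: h_def history_llr_history algebra_simps)
  finally show ?thesis .
qed

text \<open>\<open>exp (- L n)\<close> is the likelihood ratio of the false against the true state,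
  a martingale in the true state: reweighting turns the report probabilities of state
  \<open>+1\<close> into those of state \<open>-1\<close>, which also sum to 1.\<close>

lemma expectation_exp_minus_L:
  assumes "n \<ge> 1" shows "expectation (\<lambda>\<omega>. exp (- L n \<omega>)) = 1"
  using assms
proof (induction n rule: dec_induct)
  case (step n)
  have whole: "x * exp (-1 * (l + ln (x / y))) = y * exp (- l)" if "x > 0" "y > 0" for x y l :: real
  proof -
    have "exp (-1 * (l + ln (x / y))) = exp (- l) * exp (- ln (x / y))" by (simp flip: exp_add)
    also have "exp (- ln (x / y)) = y / x" using that by (simp add: exp_minus)
    finally show ?thesis using that by simp
  qed
  have "P l 1 * exp (-1 * llr_update \<epsilon> \<sigma> l 1) + (1 - P l 1) * exp (-1 * llr_update \<epsilon> \<sigma> l (-1)) =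
      P l (-1) * exp (- l) + (1 - P l (-1)) * exp (- l)" for l
    unfolding llr_update_plus llr_update_minus
    by (intro arg_cong2[where f = "(+)"] whole) (use P_bounds in auto)
  then have "P l 1 * exp (-1 * llr_update \<epsilon> \<sigma> l 1) + (1 - P l 1) * exp (-1 * llr_update \<epsilon> \<sigma> l (-1)) =
      exp (- l)" for l
    by (simp add: left_diff_distrib)
  then show ?case
    using step expectation_exp_step[of n "\<lambda>_. 1" 1 "-1"] by simp
qed (simp add: prob_space)

definition root_lr :: "nat \<Rightarrow> 'w \<Rightarrow> real" where
  "root_lr n \<omega> = exp (- L n \<omega> / 2)"

lemma borel_measurable_root_lr [measurable]: "root_lr n \<in> borel_measurable M"
  unfolding root_lr_def[abs_def] by measurable

lemma integrable_root_lr: "integrable M (root_lr n)"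
  using integrable_exp_L[of "-1/2" n] by (simp add: root_lr_def[abs_def])

lemma root_lr_pos: "root_lr n \<omega> > 0" by (simp add: root_lr_def)

lemma integrable_root_lr_mult:
  assumes [measurable]: "f \<in> borel_measurable M" and "\<And>\<omega>. \<bar>f \<omega>\<bar> \<le> 1"
  shows "integrable M (\<lambda>\<omega>. f \<omega> * root_lr n \<omega>)"
proof (rule Bochner_Integration.integrable_bound[OF integrable_root_lr[of n]])
  show "AE \<omega> in M. norm (f \<omega> * root_lr n \<omega>) \<le> norm (root_lr n \<omega>)"
    using assms(2) root_lr_pos by (intro AE_I2) (simp add: abs_mult mult_left_le_one_le)
qed measurable

text \<open>Averaging the root of the one-step likelihood ratio gives the Bhattacharyya coefficient.
  The weight \<open>g\<close> makes this a conditional statement: \<open>g = 1\<close> serves the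
  decay of the mean, indicators serve the maximal inequality.\<close>

lemma root_lr_drift:
  "\<exists>\<kappa>>0. \<forall>n\<ge>1. \<forall>g. g \<in> borel_measurable (history_space n) \<longrightarrow> (\<forall>x. 0 \<le> g x \<and> g x \<le> 1) \<longrightarrow>
    (\<integral>\<omega>. g (history n \<omega>) * root_lr (Suc n) \<omega> \<partial>M) \<le>
    (\<integral>\<omega>. g (history n \<omega>) * (1 - \<kappa> * exp (- a * \<bar>L n \<omega>\<bar>)) * root_lr n \<omega> \<partial>M)"
proof -
  obtain \<kappa> where \<kappa>: "\<kappa> > 0" and
    bc: "\<And>l. sqrt (P l 1 * P l (-1)) + sqrt ((1 - P l 1) * (1 - P l (-1))) \<le> 1 - \<kappa> * exp (- a * \<bar>l\<bar>)"
    using bhattacharyya_bound by blast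
  have eq: "P l 1 * exp (- 1 / 2 * llr_update \<epsilon> \<sigma> l 1) + (1 - P l 1) * exp (- 1 / 2 * llr_update \<epsilon> \<sigma> l (-1)) =
      (sqrt (P l 1 * P l (-1)) + sqrt ((1 - P l 1) * (1 - P l (-1)))) * exp (- l / 2)" for l
  proof -
    have half: "x * exp (- 1 / 2 * (l + ln (x / y))) = sqrt (x * y) * exp (- l / 2)" if "x > 0" "y > 0" for x y
    proof -
      have "exp (ln (x / y) / 2) = exp (ln (sqrt (x / y)))" using that by (subst ln_sqrt) auto
      also have "\<dots> = sqrt x / sqrt y" using that by (simp add: real_sqrt_divide)
      finally have e: "exp (ln (x / y) / 2) = sqrt x / sqrt y" .
      have "exp (- 1 / 2 * (l + ln (x / y))) = exp (- l / 2) * exp (- (ln (x / y) / 2))"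
        by (simp add: distrib_left flip: exp_add)
      also have "\<dots> = exp (- l / 2) * (sqrt y / sqrt x)" unfolding exp_minus e by simp
      finally have "x * exp (- 1 / 2 * (l + ln (x / y))) = (sqrt x * sqrt x) * (exp (- l / 2) * (sqrt y / sqrt x))"
        using that by simp
      also have "\<dots> = sqrt x * sqrt y * exp (- l / 2)"
      proof -
        have cancel: "(p * p) * (e * (q / p)) = p * q * e" if "p \<noteq> 0" for p q e :: real
          using that by simp
        show ?thesis using that by (intro cancel) simp
      qed
      finally show ?thesis by (simp only: real_sqrt_mult)
    qed
    show ?thesis
      unfolding llr_update_plus llr_update_minus distrib_right
      by (intro arg_cong2[where f = "(+)"] half) (use P_bounds in auto)
  qed
  have "(\<integral>\<omega>. g (history n \<omega>) * root_lr (Suc n) \<omega> \<partial>M) \<le>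
    (\<integral>\<omega>. g (history n \<omega>) * (1 - \<kappa> * exp (- a * \<bar>L n \<omega>\<bar>)) * root_lr n \<omega> \<partial>M)"
    if n: "n \<ge> 1" and g [measurable]: "g \<in> borel_measurable (history_space n)"
      and g01: "\<And>x. 0 \<le> g x \<and> g x \<le> 1" for n g
  proof -
    let ?bc = "\<lambda>l. sqrt (P l 1 * P l (-1)) + sqrt ((1 - P l 1) * (1 - P l (-1)))"
    have gb: "\<bar>g x\<bar> \<le> 1" for x using g01[of x] by simp
    have bc0: "0 \<le> ?bc l" for l using P_bounds[of l 1] P_bounds[of l "-1"] by simp
    have bc1: "?bc l \<le> 1" for l
      using bc[of l] mult_pos_pos[OF \<kappa> exp_gt_zero[of "- a * \<bar>l\<bar>"]] by linarith
    have k01: "0 \<le> 1 - \<kappa> * exp (- a * \<bar>l\<bar>)" "1 - \<kappa> * exp (- a * \<bar>l\<bar>) \<le> 1" for l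
      using bc[of l] bc0[of l] \<kappa> by (linarith, simp)
    have "(\<integral>\<omega>. g (history n \<omega>) * root_lr (Suc n) \<omega> \<partial>M) =
        (\<integral>\<omega>. g (history n \<omega>) * ?bc (L n \<omega>) * root_lr n \<omega> \<partial>M)"
      using expectation_exp_step[OF n g gb, of "- 1 / 2"]
      by (simp only: eq) (simp add: root_lr_def mult.assoc)
    also have "\<dots> \<le> (\<integral>\<omega>. g (history n \<omega>) * (1 - \<kappa> * exp (- a * \<bar>L n \<omega>\<bar>)) * root_lr n \<omega> \<partial>M)"
    proof (rule integral_mono)
      show "integrable M (\<lambda>\<omega>. g (history n \<omega>) * ?bc (L n \<omega>) * root_lr n \<omega>)"
        using g01 bc0 bc1 by (intro integrable_root_lr_mult) (auto simp: abs_mult intro!: mult_le_one)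
      show "integrable M (\<lambda>\<omega>. g (history n \<omega>) * (1 - \<kappa> * exp (- a * \<bar>L n \<omega>\<bar>)) * root_lr n \<omega>)"
        using g01 k01 by (intro integrable_root_lr_mult) (auto simp: abs_mult intro!: mult_le_one)
      show "g (history n \<omega>) * ?bc (L n \<omega>) * root_lr n \<omega> \<le>
        g (history n \<omega>) * (1 - \<kappa> * exp (- a * \<bar>L n \<omega>\<bar>)) * root_lr n \<omega>" for \<omega>
        using g01 bc root_lr_pos[of n \<omega>] by (intro mult_right_mono mult_left_mono) auto
    qed
    finally show ?thesis .
  qed
  with \<kappa> show ?thesis by blast
qed

lemma expectation_root_lr_pos: "expectation (root_lr n) > 0"
proof -
  have "exp (- (\<epsilon> * real n)) \<le> expectation (root_lr n)"
  proof (rule integral_ge_const[OF integrable_root_lr AE_I2])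
    fix \<omega>
    show "exp (- (\<epsilon> * real n)) \<le> root_lr n \<omega>"
      using pub_llr_bounded[of "\<lambda>i. s i \<omega>" "\<lambda>i. v i \<omega>" n] by (simp add: root_lr_def)
  qed
  then show ?thesis by (rule less_le_trans[OF exp_gt_zero])
qed

text \<open>Splitting at \<open>\<bar>l\<bar> = T\<close> turns the drift into a nonlinear recursion: on
  \<open>\<bar>l\<bar> > T\<close> the root of the likelihood ratio is dominated by \<open>exp (- T / 2) * (1 + exp (- l))\<close>,
  whose mean is known from the martingale property of \<open>exp (- L n)\<close>.\<close>

lemma expectation_discounted_root_lr:
  assumes n: "n \<ge> 1"
  defines "m \<equiv> expectation (root_lr n)"
  shows "(m / 2) * (m / 4) powr (2 * a) \<le> expectation (\<lambda>\<omega>. exp (- a * \<bar>L n \<omega>\<bar>) * root_lr n \<omega>)"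
proof -
  have m: "m > 0" unfolding m_def by (rule expectation_root_lr_pos)
  \<comment> \<open>Makes \<open>exp (- T / 2) = m / 4\<close>. Since \<open>1 + exp (- L n)\<close>
    has mean 2, the part beyond \<open>T\<close> then accounts for at most half of
    \<open>m\<close>.\<close>
  define T where "T = 2 * ln (4 / m)"
  let ?U = "\<lambda>\<omega>. exp (- a * \<bar>L n \<omega>\<bar>) * root_lr n \<omega>"
  have U: "integrable M ?U" using a_pos by (intro integrable_root_lr_mult) auto
  have W: "integrable M (\<lambda>\<omega>. exp (- L n \<omega>))" using integrable_exp_L[of "-1" n] by simp
  have pt: "root_lr n \<omega> \<le> exp (a * T) * ?U \<omega> + exp (- T / 2) * (1 + exp (- L n \<omega>))" for \<omega>
  proof (cases "\<bar>L n \<omega>\<bar> \<le> T")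
    case True
    have "1 \<le> exp (a * T) * exp (- a * \<bar>L n \<omega>\<bar>)"
      using True a_pos by (simp flip: exp_add)
    then have "1 * root_lr n \<omega> \<le> (exp (a * T) * exp (- a * \<bar>L n \<omega>\<bar>)) * root_lr n \<omega>"
      using root_lr_pos[of n \<omega>] by (intro mult_right_mono) auto
    then have "root_lr n \<omega> \<le> exp (a * T) * ?U \<omega>" by (simp only: mult.assoc mult_1)
    moreover have "0 \<le> exp (- T / 2) * (1 + exp (- L n \<omega>))" by (simp add: add_nonneg_nonneg)
    ultimately show ?thesis by (rule add_increasing2[rotated])
  next
    case False
    have "root_lr n \<omega> \<le> exp (- T / 2) * (1 + exp (- L n \<omega>))"
    proof (cases "L n \<omega> \<ge> 0")
      case True
      then have "root_lr n \<omega> \<le> exp (- T / 2) * 1" using False by (simp add: root_lr_def)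
      also have "\<dots> \<le> exp (- T / 2) * (1 + exp (- L n \<omega>))" by (intro mult_left_mono) auto
      finally show ?thesis .
    next
      case neg: False
      \<comment> \<open>For \<open>L n \<omega> < - T\<close> write \<open>exp (- L / 2)\<close> as
        \<open>exp (L / 2) * exp (- L)\<close>.\<close>
      have "root_lr n \<omega> \<le> exp (- T / 2) * exp (- L n \<omega>)"
        using False neg by (simp add: root_lr_def flip: exp_add)
      also have "\<dots> \<le> exp (- T / 2) * (1 + exp (- L n \<omega>))" by (intro mult_left_mono) auto
      finally show ?thesis .
    qed
    moreover have "0 \<le> exp (a * T) * ?U \<omega>" using root_lr_pos[of n \<omega>] by simp
    ultimately show ?thesis by linarith
  qed
  have "m \<le> (\<integral>\<omega>. exp (a * T) * ?U \<omega> + exp (- T / 2) * (1 + exp (- L n \<omega>)) \<partial>M)"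
    unfolding m_def by (intro integral_mono pt integrable_root_lr) (intro Bochner_Integration.integrable_add integrable_mult_right integrable_const U W)
  also have "\<dots> = exp (a * T) * expectation ?U + exp (- T / 2) * 2"
    using U W expectation_exp_minus_L[OF n] by (simp add: prob_space)
  also have "exp (- T / 2) = m / 4" using m by (simp add: T_def exp_minus)
  also have "exp (a * T) = (4 / m) powr (2 * a)" using m by (simp add: T_def powr_def mult_ac)
  finally have "m / 2 \<le> (4 / m) powr (2 * a) * expectation ?U" by simp
  then have "(m / 2) * (m / 4) powr (2 * a) \<le> ((4 / m) powr (2 * a) * expectation ?U) * (m / 4) powr (2 * a)"
    by (intro mult_right_mono) auto
  also have "\<dots> = ((4 / m) * (m / 4)) powr (2 * a) * expectation ?U"
    using m by (subst powr_mult) auto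
  finally show ?thesis using m by simp
qed

text \<open>The drift with \<open>g = 1\<close> and the bound on the discounted mean give the
  recursion of \<open>power_decay_from_recursion\<close> with \<open>r = 2 * a\<close>.\<close>

lemma expectation_root_lr_decay:
  "\<exists>C>0. \<forall>n\<ge>1. expectation (root_lr n) \<le> C * real n powr (- (1 / (2 * a)))"
proof -
  obtain \<kappa> where \<kappa>: "\<kappa> > 0" and drift: "\<And>n g. n \<ge> 1 \<Longrightarrow> g \<in> borel_measurable (history_space n) \<Longrightarrow>
    (\<And>x. 0 \<le> g x \<and> g x \<le> 1) \<Longrightarrow> (\<integral>\<omega>. g (history n \<omega>) * root_lr (Suc n) \<omega> \<partial>M) \<le>
    (\<integral>\<omega>. g (history n \<omega>) * (1 - \<kappa> * exp (- a * \<bar>L n \<omega>\<bar>)) * root_lr n \<omega> \<partial>M)"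
    using root_lr_drift by blast
  let ?m = "\<lambda>n. expectation (root_lr n)"
  define c where "c = \<kappa> * (1 / 2) * (1 / 4) powr (2 * a)"
  have c: "c > 0" using \<kappa> by (simp add: c_def)
  have rec: "?m (Suc n) \<le> ?m n - c * ?m n powr (1 + 2 * a)" if n: "n \<ge> 1" for n
  proof -
    let ?U = "\<lambda>\<omega>. exp (- a * \<bar>L n \<omega>\<bar>) * root_lr n \<omega>"
    have U: "integrable M ?U" using a_pos by (intro integrable_root_lr_mult) auto
    have "?m (Suc n) \<le> (\<integral>\<omega>. root_lr n \<omega> - \<kappa> * ?U \<omega> \<partial>M)"
      using drift[OF n, of "\<lambda>_. 1"] by (simp add: left_diff_distrib mult.assoc)
    also have "\<dots> = ?m n - \<kappa> * expectation ?U"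
      using U integrable_root_lr by simp
    also have "\<dots> \<le> ?m n - \<kappa> * ((?m n / 2) * (?m n / 4) powr (2 * a))"
      using expectation_discounted_root_lr[OF n] \<kappa> by simp
    also have "\<dots> = ?m n - c * ?m n powr (1 + 2 * a)"
    proof -
      have "(?m n / 4) powr (2 * a) = (1 / 4) powr (2 * a) * ?m n powr (2 * a)"
        using expectation_root_lr_pos[of n] powr_mult[of "1/4" "?m n" "2 * a"] by simp
      moreover have "?m n powr (1 + 2 * a) = ?m n * ?m n powr (2 * a)"
        using expectation_root_lr_pos[of n] by (simp add: powr_add)
      ultimately show ?thesis by (simp add: c_def)
    qed
    finally show ?thesis .
  qed
  show ?thesis
    using power_decay_from_recursion[where m = "\<lambda>n. expectation (root_lr n)", OF c _ expectation_root_lr_pos rec] a_pos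
    by simp
qed

lemma root_lr_supermartingale:
  assumes n: "n \<ge> 1" and g [measurable]: "g \<in> borel_measurable (history_space n)"
    and g01: "\<And>x. 0 \<le> g x \<and> g x \<le> 1"
  shows "(\<integral>\<omega>. g (history n \<omega>) * root_lr (Suc n) \<omega> \<partial>M) \<le> (\<integral>\<omega>. g (history n \<omega>) * root_lr n \<omega> \<partial>M)"
proof -
  obtain \<kappa> where \<kappa>: "\<kappa> > 0" and "(\<integral>\<omega>. g (history n \<omega>) * root_lr (Suc n) \<omega> \<partial>M) \<le>
    (\<integral>\<omega>. g (history n \<omega>) * (1 - \<kappa> * exp (- a * \<bar>L n \<omega>\<bar>)) * root_lr n \<omega> \<partial>M)"
    using root_lr_drift n g g01 by blast
  note this(2)
  also have "(\<integral>\<omega>. g (history n \<omega>) * (1 - \<kappa> * exp (- a * \<bar>L n \<omega>\<bar>)) * root_lr n \<omega> \<partial>M) \<le>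
    (\<integral>\<omega>. g (history n \<omega>) * root_lr n \<omega> \<partial>M)"
  proof (rule Bochner_Integration.integral_mono_AE')
    show "integrable M (\<lambda>\<omega>. g (history n \<omega>) * root_lr n \<omega>)"
      using g01 by (intro integrable_root_lr_mult) (auto simp: abs_of_nonneg)
    show "AE \<omega> in M. g (history n \<omega>) * (1 - \<kappa> * exp (- a * \<bar>L n \<omega>\<bar>)) * root_lr n \<omega> \<le> g (history n \<omega>) * root_lr n \<omega>"
      using \<kappa> g01 less_imp_le[OF root_lr_pos] by (intro AE_I2 mult_right_mono mult_left_le) auto
    show "AE \<omega> in M. 0 \<le> g (history n \<omega>) * root_lr n \<omega>"
      using g01 less_imp_le[OF root_lr_pos] by (intro AE_I2 mult_nonneg_nonneg) auto
  qed
  finally show ?thesis .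
qed

subsection \<open>Almost sure rate\<close>

text \<open>Doob's maximal inequality for the nonnegative supermartingale \<open>root_lr\<close>, by
  induction on the length of the window. Here \<open>\<theta>\<close> is a level, not the
  state.\<close>

lemma root_lr_maximal_inequality:
  assumes N: "N \<ge> 1" and lam: "\<theta> > 0"
  shows "\<theta> * prob {\<omega> \<in> space M. \<exists>i\<in>{N..N + k}. root_lr i \<omega> > \<theta>} \<le> expectation (root_lr N)"
proof -
  define G where "G k \<omega> = (of_bool (\<forall>i\<in>{N..N + k}. root_lr i \<omega> \<le> \<theta>) :: real)" for k \<omega>
  have G01: "0 \<le> G k \<omega> \<and> G k \<omega> \<le> 1" for k \<omega> by (simp add: G_def)
  have Gm [measurable]: "G k \<in> borel_measurable M" for k unfolding G_def[abs_def] by measurable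
  have GZ: "integrable M (\<lambda>\<omega>. G k \<omega> * root_lr n \<omega>)" for k n
    using G01 by (intro integrable_root_lr_mult) (auto simp: abs_if G_def)
  have I: "integrable M (G k)" for k
    using G01 by (intro integrable_const_bound[of _ 1]) (auto simp: G_def)
  \<comment> \<open>Paths that have exceeded the level are charged \<open>\<theta>\<close> each, the
    others keep their current value of \<open>root_lr\<close>. The total never rises above the
    initial mean.\<close>
  have main: "\<theta> * (1 - expectation (G k)) + (\<integral>\<omega>. G k \<omega> * root_lr (N + k) \<omega> \<partial>M) \<le> expectation (root_lr N)" for k
  proof (induction k)
    case 0
    have "\<theta> * (1 - expectation (G 0)) + (\<integral>\<omega>. G 0 \<omega> * root_lr N \<omega> \<partial>M)
      = (\<integral>\<omega>. \<theta> * (1 - G 0 \<omega>) + G 0 \<omega> * root_lr N \<omega> \<partial>M)"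
      using I GZ by (simp add: prob_space)
    also have "\<dots> \<le> expectation (root_lr N)"
    proof (rule integral_mono[OF _ integrable_root_lr])
      show "integrable M (\<lambda>\<omega>. \<theta> * (1 - G 0 \<omega>) + G 0 \<omega> * root_lr N \<omega>)"
        by (intro Bochner_Integration.integrable_add integrable_mult_right Bochner_Integration.integrable_diff integrable_const I GZ)
    qed (auto simp: G_def)
    finally show ?case by simp
  next
    case (Suc k)
    let ?n = "N + k"
    \<comment> \<open>The indicator \<open>G k\<close> as a function of the history, since it
      involves only beliefs up to index \<open>?n\<close>.\<close>
    define g where "g x = (of_bool (\<forall>i\<in>{N..?n}. exp (- history_llr i x / 2) \<le> \<theta>) :: real)" for x
    have "history_llr i \<in> borel_measurable (history_space ?n)" if "i \<in> {N..?n}" for i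
      using that by (intro borel_measurable_history_llr) auto
    then have g: "g \<in> borel_measurable (history_space ?n)"
      unfolding g_def[abs_def] by measurable
    have gG: "g (history ?n \<omega>) = G k \<omega>" for \<omega>
      by (auto simp: g_def G_def history_llr_history root_lr_def)
    have "(\<integral>\<omega>. G k \<omega> * root_lr (Suc ?n) \<omega> \<partial>M) \<le> (\<integral>\<omega>. G k \<omega> * root_lr ?n \<omega> \<partial>M)"
      unfolding gG[symmetric] using N by (intro root_lr_supermartingale g) (auto simp: g_def)
    moreover have "\<theta> * (expectation (G k) - expectation (G (Suc k))) + (\<integral>\<omega>. G (Suc k) \<omega> * root_lr (Suc ?n) \<omega> \<partial>M)
      = (\<integral>\<omega>. \<theta> * (G k \<omega> - G (Suc k) \<omega>) + G (Suc k) \<omega> * root_lr (Suc ?n) \<omega> \<partial>M)"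
      using I GZ by simp
    moreover have "\<dots> \<le> (\<integral>\<omega>. G k \<omega> * root_lr (Suc ?n) \<omega> \<partial>M)"
    proof (intro integral_mono GZ)
      fix \<omega>
      \<comment> \<open>Where the new constraint fails, \<open>root_lr\<close> exceeds
        \<open>\<theta>\<close>, so replacing it by \<open>\<theta>\<close> lowers the
        total.\<close>
      have "G (Suc k) \<omega> = G k \<omega> * of_bool (root_lr (Suc ?n) \<omega> \<le> \<theta>)"
        by (auto simp: G_def atLeastAtMostSuc_conv)
      then show "\<theta> * (G k \<omega> - G (Suc k) \<omega>) + G (Suc k) \<omega> * root_lr (Suc ?n) \<omega> \<le> G k \<omega> * root_lr (Suc ?n) \<omega>"
        using mult_left_mono[of \<theta> "root_lr (Suc ?n) \<omega>" "G k \<omega>"] G01[of k \<omega>]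
        by (cases "root_lr (Suc ?n) \<omega> \<le> \<theta>") (simp_all add: mult.commute)
    qed (intro Bochner_Integration.integrable_add integrable_mult_right Bochner_Integration.integrable_diff I GZ)
    ultimately have "\<theta> * (expectation (G k) - expectation (G (Suc k))) + (\<integral>\<omega>. G (Suc k) \<omega> * root_lr (Suc ?n) \<omega> \<partial>M)
      \<le> (\<integral>\<omega>. G k \<omega> * root_lr ?n \<omega> \<partial>M)" by linarith
    with Suc show ?case by (simp add: algebra_simps)
  qed
  have "prob {\<omega> \<in> space M. \<exists>i\<in>{N..N + k}. root_lr i \<omega> > \<theta>} =
      expectation (indicator {\<omega> \<in> space M. \<exists>i\<in>{N..N + k}. root_lr i \<omega> > \<theta>})"
    by simp
  also have "\<dots> = expectation (\<lambda>\<omega>. 1 - G k \<omega>)"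
    by (intro Bochner_Integration.integral_cong) (auto simp: G_def indicator_def not_le)
  also have "\<dots> = 1 - expectation (G k)" using I by (simp add: prob_space)
  finally have *: "prob {\<omega> \<in> space M. \<exists>i\<in>{N..N + k}. root_lr i \<omega> > \<theta>} = 1 - expectation (G k)" .
  have "0 \<le> (\<integral>\<omega>. G k \<omega> * root_lr (N + k) \<omega> \<partial>M)"
    using G01 less_imp_le[OF root_lr_pos] by (intro Bochner_Integration.integral_nonneg mult_nonneg_nonneg) auto
  then show ?thesis using main[of k] unfolding * by linarith
qed

text \<open>On dyadic blocks the mean decays with exponent \<open>q\<close> while the level decays
  only with exponent \<open>(1 - d) * q\<close>. The surplus \<open>d * q\<close> makes the
  exceedance probabilities geometric in \<open>k\<close>, hence summable.\<close>

lemma AE_L_lower: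
  assumes d: "0 < d" "d < 1"
  shows "AE \<omega> in M. \<forall>\<^sub>F n in sequentially. L n \<omega> \<ge> (1 - d) / a * ln (real n)"
proof -
  define q where "q = 1 / (2 * a)"
  have q: "q > 0" using a_pos by (simp add: q_def)
  obtain C where C: "C > 0" and decay: "\<And>n. n \<ge> 1 \<Longrightarrow> expectation (root_lr n) \<le> C * real n powr (- q)"
    using expectation_root_lr_decay unfolding q_def by blast
  \<comment> \<open>The target at the right end of the block, so that it lies below
    \<open>real n powr (- ((1 - d) * q))\<close> for every \<open>n\<close> in the block.\<close>
  define lam where "lam k = real (2 ^ Suc k) powr (- ((1 - d) * q))" for k :: nat
  have lam: "lam k > 0" for k by (simp add: lam_def)
  define Ev where "Ev k = {\<omega> \<in> space M. \<exists>i\<in>{2^k..2^k + 2^k}. root_lr i \<omega> > lam k}" for k :: nat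
  have Ev_meas [measurable]: "Ev k \<in> sets M" for k unfolding Ev_def by measurable
  define \<rho> where "\<rho> = 2 powr (- (d * q))"
  have \<rho>: "0 < \<rho>" "\<rho> < 1" using d q by (auto simp: \<rho>_def powr_less_one)
  define C' where "C' = C * 2 powr ((1 - d) * q)"
  have bound: "prob (Ev k) \<le> C' * \<rho> ^ k" for k
  proof -
    have p2: "real (2 ^ j) powr x = 2 powr (x * real j)" for j x
    proof -
      have "real (2 ^ j) = 2 powr real j" by (simp add: powr_realpow)
      then show ?thesis by (simp only: powr_powr mult.commute)
    qed
    have "lam k * prob (Ev k) \<le> C * real (2 ^ k) powr (- q)"
      using root_lr_maximal_inequality[of "2 ^ k" "lam k" "2 ^ k"] lam[of k] decay[of "2 ^ k"]
      by (simp add: Ev_def)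
    then have "prob (Ev k) \<le> C * real (2 ^ k) powr (- q) / lam k"
      using lam[of k] by (simp add: field_simps)
    also have "\<dots> = C * 2 powr (- q * real k - (- ((1 - d) * q) * real (Suc k)))"
      unfolding lam_def p2 by (simp only: powr_diff times_divide_eq_right)
    also have "- q * real k - (- ((1 - d) * q) * real (Suc k)) = (1 - d) * q + - (d * q) * real k"
      by (simp add: algebra_simps)
    also have "2 powr \<dots> = 2 powr ((1 - d) * q) * \<rho> powr real k"
      unfolding \<rho>_def by (simp only: powr_add powr_powr)
    also have "C * \<dots> = C' * \<rho> ^ k"
      using \<rho> by (simp add: C'_def powr_realpow)
    finally show ?thesis .
  qed
  have "AE \<omega> in M. eventually (\<lambda>k. \<omega> \<in> space M - Ev k) sequentially"
  proof (rule borel_cantelli_AE1)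
    show "summable (\<lambda>k. measure M (Ev k))"
    proof (rule summable_comparison_test')
      show "summable (\<lambda>k. C' * \<rho> ^ k)" using \<rho> by (intro summable_mult summable_geometric) auto
      show "norm (measure M (Ev k)) \<le> C' * \<rho> ^ k" if "k \<ge> 0" for k using bound[of k] by simp
    qed
  qed (simp_all add: emeasure_eq_measure)
  then show ?thesis
  proof (eventually_elim)
    case (elim \<omega>)
    then obtain k0 where k0: "\<And>k. k \<ge> k0 \<Longrightarrow> \<omega> \<in> space M - Ev k" by (auto simp: eventually_sequentially)
    have "L n \<omega> \<ge> (1 - d) / a * ln (real n)" if n: "n \<ge> 2 ^ k0" for n
    proof -
      have n0: "n > 0" using n by (cases n) auto
      obtain k where k: "2 ^ k \<le> n" "n < 2 ^ Suc k"
        using ex_power_ivl1[of 2 n] n0 by auto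
      have "2 ^ k0 < (2::nat) ^ Suc k" using n k(2) by linarith
      then have "k0 \<le> k" by (simp add: power_strict_increasing_iff del: power_Suc)
      then have "root_lr n \<omega> \<le> lam k" using k0[of k] k by (auto simp: Ev_def not_less)
      also have "\<dots> \<le> real n powr (- ((1 - d) * q))"
        unfolding lam_def
      proof (rule powr_mono2')
        show "real n \<le> real (2 ^ Suc k)" using k(2) by (simp only: of_nat_le_iff less_imp_le)
      qed (use n0 d q in auto)
      finally have "ln (root_lr n \<omega>) \<le> ln (real n powr (- ((1 - d) * q)))"
        using root_lr_pos[of n \<omega>] n0 by (subst ln_le_cancel_iff) auto
      then have "(1 - d) * q * ln (real n) \<le> L n \<omega> / 2"
        using n0 by (simp add: root_lr_def ln_powr)
      then show ?thesis by (simp add: q_def)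
    qed
    then show ?case by (auto simp: eventually_sequentially)
  qed
qed

end

section \<open>The normalising sequence and the pathwise upper bound\<close>

context privacy_params
begin

lemma C_const_pos: "C_const \<epsilon> \<sigma> > 0"
  using eps_pos sigma_pos by (simp add: C_const_def)

lemma f_rate_eq: "f_rate \<epsilon> \<sigma> n = ln (C_const \<epsilon> \<sigma> * real n) / a"
  using eps_pos sigma_pos by (simp add: f_rate_def a_def)

text \<open>A positive factor inside the logarithm adds a constant, which vanishes relative to
  \<open>ln (real n)\<close>.\<close>

lemma ln_mult_div_ln_tendsto:
  assumes "c > 0" shows "(\<lambda>n. ln (c * real n) / ln (real n)) \<longlonglongrightarrow> 1"
  using assms by real_asymp

lemma f_rate_asymp_equiv: "f_rate \<epsilon> \<sigma> \<sim>[at_top] (\<lambda>n. 2 / (\<epsilon> * \<sigma>\<^sup>2) * ln (real n))"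
proof (rule asymp_equivI')
  have "(\<lambda>n. f_rate \<epsilon> \<sigma> n / (2 / (\<epsilon> * \<sigma>\<^sup>2) * ln (real n))) = (\<lambda>n. ln (C_const \<epsilon> \<sigma> * real n) / ln (real n))"
    using eps_pos sigma_pos by (simp add: f_rate_def)
  then show "(\<lambda>n. f_rate \<epsilon> \<sigma> n / (2 / (\<epsilon> * \<sigma>\<^sup>2) * ln (real n))) \<longlonglongrightarrow> 1"
    using ln_mult_div_ln_tendsto[OF C_const_pos] by simp
qed

text \<open>Holds on every path, by taking logarithms in the linear growth bound.\<close>

lemma pub_llr_div_ln_upper:
  assumes "y > 1" shows "\<forall>\<^sub>F n in sequentially. a * pub_llr \<epsilon> \<sigma> s v n / ln (real n) < y"
proof -
  obtain D where D: "D > 0" "\<And>n. exp (a * pub_llr \<epsilon> \<sigma> s v n) \<le> 1 + D * real n"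
    using exp_pub_llr_linear_growth by blast
  have "(\<lambda>n. ln (1 + D * real n) / ln (real n)) \<longlonglongrightarrow> 1" using D(1) by real_asymp
  then have "\<forall>\<^sub>F n in sequentially. ln (1 + D * real n) / ln (real n) < y"
    using assms by (rule order_tendstoD)
  then show ?thesis
    using eventually_gt_at_top[of 1]
  proof eventually_elim
    case (elim n)
    have "ln (exp (a * pub_llr \<epsilon> \<sigma> s v n)) \<le> ln (1 + D * real n)"
      using D(2)[of n] D(1) by (subst ln_le_cancel_iff) (auto intro: add_pos_nonneg)
    then have "a * pub_llr \<epsilon> \<sigma> s v n / ln (real n) \<le> ln (1 + D * real n) / ln (real n)"
      using elim(2) by (intro divide_right_mono) auto
    with elim(1) show ?case by linarith
  qed
qed

end

section \<open>Almost sure convergence of the ratio\<close>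

context gaussian_learning
begin

lemma AE_L_div_f_rate: "AE \<omega> in M. (\<lambda>n. L n \<omega> / f_rate \<epsilon> \<sigma> n) \<longlonglongrightarrow> 1"
proof -
  \<comment> \<open>Countably many values of \<open>d\<close> tending to 0 allow a single null set;
    the offset 2 keeps \<open>d < 1\<close> already at \<open>j = 0\<close>.\<close>
  have "AE \<omega> in M. \<forall>j. \<forall>\<^sub>F n in sequentially. L n \<omega> \<ge> (1 - 1 / real (j + 2)) / a * ln (real n)"
    unfolding AE_all_countable by (intro allI AE_L_lower) auto
  then show ?thesis
  proof eventually_elim
    case (elim \<omega>)
    have "(\<lambda>n. a * L n \<omega> / ln (real n)) \<longlonglongrightarrow> 1"
    proof (rule order_tendstoI)
      fix y :: real assume "y > 1"
      then show "\<forall>\<^sub>F n in sequentially. a * L n \<omega> / ln (real n) < y" by (rule pub_llr_div_ln_upper)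
    next
      fix y :: real assume y: "y < 1"
      obtain j where "1 / real (Suc j) < 1 - y" using y reals_Archimedean[of "1 - y"] by (auto simp: inverse_eq_divide)
      moreover have "1 / real (j + 2) \<le> 1 / real (Suc j)" by (intro divide_left_mono) auto
      ultimately have j: "y < 1 - 1 / real (j + 2)" by linarith
      from elim[rule_format, of j] eventually_gt_at_top[of 1]
      show "\<forall>\<^sub>F n in sequentially. y < a * L n \<omega> / ln (real n)"
      proof eventually_elim
        case (elim n)
        have "(1 - 1 / real (j + 2)) * ln (real n) \<le> a * L n \<omega>"
          using mult_left_mono[OF elim(1) less_imp_le[OF a_pos]] a_pos by simp
        then have "1 - 1 / real (j + 2) \<le> a * L n \<omega> / ln (real n)"
          using elim(2) by (simp add: pos_le_divide_eq)
        with j show ?case by linarith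
      qed
    qed
    \<comment> \<open>The limit was shown relative to \<open>ln (real n) / a\<close>; dividing by
      the second limit passes to \<open>f_rate\<close>.\<close>
    from tendsto_divide[OF this ln_mult_div_ln_tendsto[OF C_const_pos]]
    have "(\<lambda>n. (a * L n \<omega> / ln (real n)) / (ln (C_const \<epsilon> \<sigma> * real n) / ln (real n))) \<longlonglongrightarrow> 1"
      by simp
    moreover have "\<forall>\<^sub>F n in sequentially. (a * L n \<omega> / ln (real n)) / (ln (C_const \<epsilon> \<sigma> * real n) / ln (real n))
        = L n \<omega> / f_rate \<epsilon> \<sigma> n"
      using eventually_gt_at_top[of 1]
    proof eventually_elim
      case (elim n)
      then have "ln (real n) > 0" by simp
      then show ?case by (simp add: f_rate_eq mult.commute)
    qed
    ultimately show ?case by (rule Lim_transform_eventually)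
  qed
qed

end

theorem theorem6:
  fixes M :: "'w measure" and \<epsilon> \<sigma> :: real
    and s v :: "nat \<Rightarrow> 'w \<Rightarrow> real"
  assumes "prob_space M"
    and "\<epsilon> > 0" and "\<sigma> > 0"
    and "\<And>i. i \<ge> 1 \<Longrightarrow> distributed M lborel (s i) (normal_density 1 \<sigma>)"
    and "\<And>i. i \<ge> 1 \<Longrightarrow> distributed M lborel (v i) (\<lambda>x. indicator {0..1} x / measure lborel {0..(1::real)})"
    and "prob_space.indep_vars M (\<lambda>_. borel)
           (\<lambda>(b, i). if b then s i else v i) (UNIV \<times> {1..})"
  shows "(AE \<omega> in M. (\<lambda>n. pub_llr \<epsilon> \<sigma> (\<lambda>i. s i \<omega>) (\<lambda>i. v i \<omega>) n / f_rate \<epsilon> \<sigma> n)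
            \<longlonglongrightarrow> 1)
         \<and> f_rate \<epsilon> \<sigma> \<sim>[at_top] (\<lambda>n. 2 / (\<epsilon> * \<sigma>\<^sup>2) * ln (real n))"
proof -
  interpret gaussian_learning \<epsilon> \<sigma> M s v
    using assms
    by (intro gaussian_learning.intro privacy_params.intro gaussian_learning_axioms.intro)
  show ?thesis using AE_L_div_f_rate f_rate_asymp_equiv by blast
qed

end
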